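(* Let $\mathbb{F}$ be a field and work in the algebraic model where each field operation takes $O(1)$ time. Suppose we are given a matrix $A\in\mathbb{F}^{n\times n}$ with $m$ non-zero entries, a zero forcing set $Z$ of $A$ of size $k$ (with its chronological list of forces and terminal set $T$), and the core matrix $B$ of $A$ represented by its LSP decomposition. Then for any $b\in\mathbb{F}^n$, the system $Ax=b$ can be solved (outputting some $x$ with $Ax=b$, or reporting that none exists) in $O(k^2+m)$ time.
   Context: Let $G=(V,E)$, $V=[n]$, be the directed graph with $(u,v)\in E$ iff $u\neq v$ and $A_{u,v}\neq0$. Zero forcing: starting from a blue set $Z$, a blue vertex with exactly one non-blue out-neighbour $u$ forces $u$ (colours it blue); $Z$ is a zero forcing set if this eventually colours all of $V$ blue. A chronological list of forces $\pi$ is an ordering $u_1,\dots,u_{n-|Z|}$ of $V\setminus Z$ together with, for each $u_i$, a forcing parent $u_i^{\uparrow}\in Z\cup\{u_1,\dots,u_{i-1}\}$ such that $u_i$ is the only out-neighbour of $u_i^{\uparrow}$ outside $Z\cup\{u_1,\dots,u_{i-1}\}$. A terminal is a vertex that is the forcing parent of no vertex; $T$ is the set of terminals. $\textsc{Forcing}(A,Z,b)$: set $x\gets0$; for each $u\in V\setminus Z$ in the order $\pi$, set $x_u\gets (b_{u^{\uparrow}}-A_{u^{\uparrow},*}x)/A_{u^{\uparrow},u}$; return $x$. With $R(b)=b-A\,\textsc{Forcing}(A,Z,b)$, the core matrix is $B\in\mathbb{F}^{T\times Z}$ whose column $v\in Z$ is $R(a_v)_T$, $a_v$ being column $v$ of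 $A$. An LSP decomposition of $B$ is $B=LSP$ with $L$ lower triangular with unit diagonal, $S$ a matrix which after deleting its zero rows is upper triangular with non-zero diagonal entries, and $P$ a permutation matrix. *)

theory Defs
  imports "Jordan_Normal_Form.Matrix" "HOL-Combinatorics.Permutations"
begin

section \<open>An algebraic random access machine\<close>

text \<open>
  The machine has an integer memory and a field memory, each consisting of variables and
  zero-initialised arrays. Field elements can only be combined by the field operations and tested
  for zero. On the integer side only successor, predecessor and comparison are available, so that
  no integer ever exceeds the largest number in the input or in the program by more than the
  number of steps executed; hence unit cost cannot be abused by computing with huge integers.
  Field constants are restricted to 0 and 1. Every node of every evaluated expression costs one
  unit of time, and so does every executed command.
\<close>

datatype iexp =
    N nat
  | IVar string
  | IArr string iexp
  | Succ iexp
  | Pred iexp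

datatype fexp =
    FZero
  | FOne
  | FVar string
  | FArr string iexp
  | FAdd fexp fexp
  | FSub fexp fexp
  | FMul fexp fexp
  | FDiv fexp fexp

datatype bexp =
    ILess iexp iexp
  | IEq iexp iexp
  | FIsZero fexp
  | BNot bexp
  | BAnd bexp bexp

datatype com =
    Skip
  | ISet string iexp
  | IStore string iexp iexp
  | FSet string fexp
  | FStore string iexp fexp
  | Seq com com
  | If bexp com com
  | While bexp com

record 'a state =
  ivar :: "string \<Rightarrow> nat"
  iarr :: "string \<Rightarrow> nat \<Rightarrow> nat"
  fvar :: "string \<Rightarrow> 'a"
  farr :: "string \<Rightarrow> nat \<Rightarrow> 'a"

fun ival :: "iexp \<Rightarrow> 'a state \<Rightarrow> nat" where
  "ival (N c) s = c"
| "ival (IVar x) s = ivar s x"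
| "ival (IArr x e) s = iarr s x (ival e s)"
| "ival (Succ e) s = Suc (ival e s)"
| "ival (Pred e) s = ival e s - 1"

fun fval :: "fexp \<Rightarrow> 'a::field state \<Rightarrow> 'a" where
  "fval FZero s = 0"
| "fval FOne s = 1"
| "fval (FVar x) s = fvar s x"
| "fval (FArr x e) s = farr s x (ival e s)"
| "fval (FAdd e f) s = fval e s + fval f s"
| "fval (FSub e f) s = fval e s - fval f s"
| "fval (FMul e f) s = fval e s * fval f s"
| "fval (FDiv e f) s = fval e s / fval f s"

text \<open>Division by zero is not a legal operation: the machine gets stuck
  (in contrast to the convention \<open>x / 0 = 0\<close> of the logic).\<close>

fun fdefined :: "fexp \<Rightarrow> 'a::field state \<Rightarrow> bool" where
  "fdefined FZero s \<longleftrightarrow> True"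
| "fdefined FOne s \<longleftrightarrow> True"
| "fdefined (FVar x) s \<longleftrightarrow> True"
| "fdefined (FArr x e) s \<longleftrightarrow> True"
| "fdefined (FAdd e f) s \<longleftrightarrow> fdefined e s \<and> fdefined f s"
| "fdefined (FSub e f) s \<longleftrightarrow> fdefined e s \<and> fdefined f s"
| "fdefined (FMul e f) s \<longleftrightarrow> fdefined e s \<and> fdefined f s"
| "fdefined (FDiv e f) s \<longleftrightarrow> fdefined e s \<and> fdefined f s \<and> fval f s \<noteq> 0"

fun bval :: "bexp \<Rightarrow> 'a::field state \<Rightarrow> bool" where
  "bval (ILess e f) s \<longleftrightarrow> ival e s < ival f s"
| "bval (IEq e f) s \<longleftrightarrow> ival e s = ival f s"
| "bval (FIsZero e) s \<longleftrightarrow> fval e s = 0"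
| "bval (BNot c) s \<longleftrightarrow> \<not> bval c s"
| "bval (BAnd c d) s \<longleftrightarrow> bval c s \<and> bval d s"

fun bdefined :: "bexp \<Rightarrow> 'a::field state \<Rightarrow> bool" where
  "bdefined (ILess e f) s \<longleftrightarrow> True"
| "bdefined (IEq e f) s \<longleftrightarrow> True"
| "bdefined (FIsZero e) s \<longleftrightarrow> fdefined e s"
| "bdefined (BNot c) s \<longleftrightarrow> bdefined c s"
| "bdefined (BAnd c d) s \<longleftrightarrow> bdefined c s \<and> bdefined d s"

fun icost :: "iexp \<Rightarrow> nat" where
  "icost (N c) = 1"
| "icost (IVar x) = 1"
| "icost (IArr x e) = 1 + icost e"
| "icost (Succ e) = 1 + icost e"
| "icost (Pred e) = 1 + icost e"

fun fcost :: "fexp \<Rightarrow> nat" where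
  "fcost FZero = 1"
| "fcost FOne = 1"
| "fcost (FVar x) = 1"
| "fcost (FArr x e) = 1 + icost e"
| "fcost (FAdd e f) = 1 + fcost e + fcost f"
| "fcost (FSub e f) = 1 + fcost e + fcost f"
| "fcost (FMul e f) = 1 + fcost e + fcost f"
| "fcost (FDiv e f) = 1 + fcost e + fcost f"

fun bcost :: "bexp \<Rightarrow> nat" where
  "bcost (ILess e f) = 1 + icost e + icost f"
| "bcost (IEq e f) = 1 + icost e + icost f"
| "bcost (FIsZero e) = 1 + fcost e"
| "bcost (BNot c) = 1 + bcost c"
| "bcost (BAnd c d) = 1 + bcost c + bcost d"

text \<open>\<open>exec c s t s'\<close>: started in \<open>s\<close>, the command \<open>c\<close> halts in state \<open>s'\<close> after \<open>t\<close> units of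
  time.\<close>

inductive exec :: "com \<Rightarrow> 'a::field state \<Rightarrow> nat \<Rightarrow> 'a state \<Rightarrow> bool" where
  Skip: "exec Skip s 1 s"
| ISet: "exec (ISet x e) s (1 + icost e) (s\<lparr>ivar := (ivar s)(x := ival e s)\<rparr>)"
| IStore: "exec (IStore x e f) s (1 + icost e + icost f)
    (s\<lparr>iarr := (iarr s)(x := (iarr s x)(ival e s := ival f s))\<rparr>)"
| FSet: "fdefined e s \<Longrightarrow>
    exec (FSet x e) s (1 + fcost e) (s\<lparr>fvar := (fvar s)(x := fval e s)\<rparr>)"
| FStore: "fdefined f s \<Longrightarrow> exec (FStore x e f) s (1 + icost e + fcost f)
    (s\<lparr>farr := (farr s)(x := (farr s x)(ival e s := fval f s))\<rparr>)"
| Seq: "exec c s t s' \<Longrightarrow> exec d s' t' s'' \<Longrightarrow> exec (Seq c d) s (1 + t + t') s''"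
| IfTrue: "bdefined b s \<Longrightarrow> bval b s \<Longrightarrow> exec c s t s' \<Longrightarrow>
    exec (If b c d) s (1 + bcost b + t) s'"
| IfFalse: "bdefined b s \<Longrightarrow> \<not> bval b s \<Longrightarrow> exec d s t s' \<Longrightarrow>
    exec (If b c d) s (1 + bcost b + t) s'"
| WhileFalse: "bdefined b s \<Longrightarrow> \<not> bval b s \<Longrightarrow> exec (While b c) s (1 + bcost b) s"
| WhileTrue: "bdefined b s \<Longrightarrow> bval b s \<Longrightarrow> exec c s t s' \<Longrightarrow> exec (While b c) s' t' s'' \<Longrightarrow>
    exec (While b c) s (1 + bcost b + t + t') s''"

inductive_cases exec_elims:
  "exec Skip s t s'" "exec (ISet x e) s t s'" "exec (IStore x e f) s t s'"
  "exec (FSet x g) s t s'" "exec (FStore x e g) s t s'" "exec (Seq c d) s t s'"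
  "exec (If b c d) s t s'"

inductive_cases exec_While: "exec (While b c) s t s'"

lemma exec_deterministic:
  "exec c s t s' \<Longrightarrow> exec c s u s'' \<Longrightarrow> u = t \<and> s'' = s'"
proof (induction arbitrary: u s'' rule: exec.induct)
  case (Seq c s t s' d t' s1)
  obtain t1 t2 r where "exec c s t1 r" "exec d r t2 s''" "u = 1 + t1 + t2"
    using Seq.prems by (rule exec_elims(6)) simp
  then show ?case
    using Seq.IH by metis
next
  case (IfTrue b s c t s' d)
  obtain v where "exec c s v s''" "u = 1 + bcost b + v"
    using IfTrue.prems by (rule exec_elims(7)) (use IfTrue.hyps in simp_all)
  then show ?case
    using IfTrue.IH by metis
next
  case (IfFalse b s d t s' c)
  obtain v where "exec d s v s''" "u = 1 + bcost b + v"
    using IfFalse.prems by (rule exec_elims(7)) (use IfFalse.hyps in simp_all)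
  then show ?case
    using IfFalse.IH by metis
next
  case (WhileFalse b s c)
  from WhileFalse.prems show ?case
    by (rule exec_While) (use WhileFalse.hyps in simp_all)
next
  case (WhileTrue b s c t s' t' s1)
  obtain t1 t2 r where "exec c s t1 r" "exec (While b c) r t2 s''" "u = 1 + bcost b + t1 + t2"
    using WhileTrue.prems by (rule exec_While) (use WhileTrue.hyps in simp_all)
  then show ?case
    using WhileTrue.IH by metis
qed (erule exec_elims; simp)+


section \<open>Zero forcing\<close>

text \<open>The vertices are the indices \<open>0, \<dots>, n - 1\<close> of the \<open>n \<times> n\<close> matrix.\<close>

definition edges :: "'a::zero mat \<Rightarrow> (nat \<times> nat) set" where
  "edges A = {(u, v). u < dim_row A \<and> v < dim_row A \<and> u \<noteq> v \<and> A $$ (u, v) \<noteq> 0}"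

definition out_neighbours :: "'a::zero mat \<Rightarrow> nat \<Rightarrow> nat set" where
  "out_neighbours A u = {v. (u, v) \<in> edges A}"

definition forces :: "'a::zero mat \<Rightarrow> nat set \<Rightarrow> nat \<Rightarrow> nat \<Rightarrow> bool" where
  "forces A S w u \<longleftrightarrow> w \<in> S \<and> out_neighbours A w - S = {u}"

definition force_step :: "'a::zero mat \<Rightarrow> nat set \<Rightarrow> nat set \<Rightarrow> bool" where
  "force_step A S S' \<longleftrightarrow> (\<exists>w u. forces A S w u \<and> S' = insert u S)"

definition zero_forcing_set :: "'a::zero mat \<Rightarrow> nat set \<Rightarrow> bool" where
  "zero_forcing_set A Z \<longleftrightarrow> Z \<subseteq> {..<dim_row A} \<and> (force_step A)\<^sup>*\<^sup>* Z {..<dim_row A}"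

text \<open>A chronological list of forces is the list of the pairs \<open>(u\<^sub>i, parent of u\<^sub>i)\<close>.\<close>

definition chronological_list :: "'a::zero mat \<Rightarrow> nat set \<Rightarrow> (nat \<times> nat) list \<Rightarrow> bool" where
  "chronological_list A Z \<pi> \<longleftrightarrow>
     distinct (map fst \<pi>) \<and> set (map fst \<pi>) = {..<dim_row A} - Z \<and>
     (\<forall>i < length \<pi>. forces A (Z \<union> set (map fst (take i \<pi>))) (snd (\<pi> ! i)) (fst (\<pi> ! i)))"

definition terminals :: "'a::zero mat \<Rightarrow> (nat \<times> nat) list \<Rightarrow> nat set" where
  "terminals A \<pi> = {..<dim_row A} - set (map snd \<pi>)"

definition Forcing :: "'a::field mat \<Rightarrow> (nat \<times> nat) list \<Rightarrow> 'a vec \<Rightarrow> 'a vec" where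
  "Forcing A \<pi> b =
     foldl (\<lambda>x (u, p). update_vec x u ((b $ p - row A p \<bullet> x) / A $$ (p, u)))
       (0\<^sub>v (dim_row A)) \<pi>"

definition residual :: "'a::field mat \<Rightarrow> (nat \<times> nat) list \<Rightarrow> 'a vec \<Rightarrow> 'a vec" where
  "residual A \<pi> b = b - A *\<^sub>v Forcing A \<pi> b"

text \<open>The core matrix is indexed by \<open>T \<times> Z\<close>; the lists \<open>ts\<close> and \<open>zs\<close> enumerate \<open>T\<close> and \<open>Z\<close>.\<close>

definition core_matrix ::
  "'a::field mat \<Rightarrow> (nat \<times> nat) list \<Rightarrow> nat list \<Rightarrow> nat list \<Rightarrow> 'a mat" where
  "core_matrix A \<pi> ts zs =
     mat (length ts) (length zs) (\<lambda>(i, j). residual A \<pi> (col A (zs ! j)) $ (ts ! i))"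


section \<open>LSP decompositions\<close>

definition permutation_matrix :: "'a::zero_neq_one mat \<Rightarrow> bool" where
  "permutation_matrix P \<longleftrightarrow>
     (\<exists>p. p permutes {..<dim_row P} \<and>
        P = mat (dim_row P) (dim_row P) (\<lambda>(i, j). if j = p i then 1 else 0))"

definition delete_zero_rows :: "'a::zero mat \<Rightarrow> 'a mat" where
  "delete_zero_rows S =
     mat_of_rows (dim_col S) (filter (\<lambda>r. r \<noteq> 0\<^sub>v (dim_col S)) (rows S))"

definition is_LSP :: "'a::field mat \<Rightarrow> 'a mat \<Rightarrow> 'a mat \<Rightarrow> 'a mat \<Rightarrow> bool" where
  "is_LSP B L S P \<longleftrightarrow>
     L \<in> carrier_mat (dim_row B) (dim_row B) \<and>
     S \<in> carrier_mat (dim_row B) (dim_col B) \<and>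
     P \<in> carrier_mat (dim_col B) (dim_col B) \<and>
     B = L * S * P \<and>
     (\<forall>i < dim_row L. L $$ (i, i) = 1 \<and> (\<forall>j < dim_col L. i < j \<longrightarrow> L $$ (i, j) = 0)) \<and>
     upper_triangular (delete_zero_rows S) \<and>
     (\<forall>i < dim_row (delete_zero_rows S). delete_zero_rows S $$ (i, i) \<noteq> 0) \<and>
     permutation_matrix P"


section \<open>Input and output conventions\<close>

definition nonzero_positions :: "'a::zero mat \<Rightarrow> (nat \<times> nat) set" where
  "nonzero_positions A = {(i, j). i < dim_row A \<and> j < dim_col A \<and> A $$ (i, j) \<noteq> 0}"

text \<open>Sparse representation: the non-zero entries in arbitrary order, each of them once.\<close>

definition represents :: "(nat \<times> nat \<times> 'a::zero) list \<Rightarrow> 'a mat \<Rightarrow> bool" where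
  "represents es A \<longleftrightarrow>
     distinct es \<and> set es = (\<lambda>(i, j). (i, j, A $$ (i, j))) ` nonzero_positions A"

definition list_array :: "'b::zero list \<Rightarrow> nat \<Rightarrow> 'b" where
  "list_array xs i = (if i < length xs then xs ! i else 0)"

definition vec_array :: "'b::zero vec \<Rightarrow> nat \<Rightarrow> 'b" where
  "vec_array v i = (if i < dim_vec v then v $ i else 0)"

definition row_major :: "'b::zero mat \<Rightarrow> nat \<Rightarrow> 'b" where
  "row_major M p =
     (if p < dim_row M * dim_col M then M $$ (p div dim_col M, p mod dim_col M) else 0)"

text \<open>The two lists \<open>zs\<close> and \<open>ts\<close> have the same length \<open>k\<close>, because the
  forcing parents are pairwise different; so \<open>L\<close>, \<open>S\<close> and \<open>P\<close> are \<open>k \<times> k\<close> matrices.\<close>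

definition input_state ::
  "nat \<Rightarrow> (nat \<times> nat \<times> 'a::field) list \<Rightarrow> nat list \<Rightarrow> (nat \<times> nat) list \<Rightarrow> nat list \<Rightarrow>
   'a mat \<Rightarrow> 'a mat \<Rightarrow> 'a mat \<Rightarrow> 'a vec \<Rightarrow> 'a state" where
  "input_state n es zs \<pi> ts L S P b =
    \<lparr> ivar = (\<lambda>_. 0)(''n'' := n, ''m'' := length es, ''k'' := length zs, ''q'' := length \<pi>),
      iarr = (\<lambda>_ _. 0)
        (''A_row'' := list_array (map fst es),
         ''A_col'' := list_array (map (fst \<circ> snd) es),
         ''Z'' := list_array zs,
         ''T'' := list_array ts,
         ''forced'' := list_array (map fst \<pi>),
         ''parent'' := list_array (map snd \<pi>)),
      fvar = (\<lambda>_. 0),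
      farr = (\<lambda>_ _. 0)
        (''A_val'' := list_array (map (snd \<circ> snd) es),
         ''L'' := row_major L,
         ''S'' := row_major S,
         ''P'' := row_major P,
         ''b'' := vec_array b) \<rparr>"

definition reports_solvable :: "'a state \<Rightarrow> bool" where
  "reports_solvable s \<longleftrightarrow> ivar s ''solvable'' \<noteq> 0"

definition output_vec :: "nat \<Rightarrow> 'a state \<Rightarrow> 'a vec" where
  "output_vec n s = vec n (farr s ''x'')"

definition correct_output :: "'a::field mat \<Rightarrow> 'a vec \<Rightarrow> 'a state \<Rightarrow> bool" where
  "correct_output A b s \<longleftrightarrow>
     (if reports_solvable s then A *\<^sub>v output_vec (dim_col A) s = b
      else \<not> (\<exists>x \<in> carrier_vec (dim_col A). A *\<^sub>v x = b))"

end

theory Submission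
  imports Defs
begin

text \<open>
  Keep the entries of each row of \<open>A\<close> in a linked list. A forcing pass then reads only the rows of the
  forcing parents, which are pairwise distinct, so it costs \<open>O(n - k + m)\<close>; and \<open>n - k \<le> m\<close>, because every
  force uses its own non-zero entry. Forcing may start from arbitrary values \<open>z\<close> on \<open>Z\<close>: the result is the
  unique vector with these values on \<open>Z\<close> that satisfies the equations of all forcing parents. By
  uniqueness it depends affinely on \<open>z\<close>, and its defect on the terminals is \<open>R(b)\<^sub>T - B z\<close>. Hence \<open>A x = b\<close>
  is solvable iff \<open>B z = R(b)\<^sub>T\<close> is, and a solution \<open>z\<close> extends to a solution \<open>x\<close> by a second pass.
  The core system is solved in \<open>O(k\<^sup>2)\<close>: forward substitution in \<open>L\<close>, a check that the right-hand side
  vanishes on the zero rows of \<open>S\<close>, back substitution in the other rows with the free variables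
  set to zero, and the permutation.
\<close>

section \<open>Execution within a time bound\<close>

text \<open>The machine has neither multiplication of integers nor direct access to a single entry
  of \<open>A\<close>, and this shapes the program. The address \<open>i * k + j\<close> of a dense
  entry is carried along by a running pointer, and the row starts are recorded on the way forward
  because back substitution needs them in reverse order. A pivot of \<open>A\<close> is picked up
  while its row is scanned.

  Unknowns are zero until they are assigned, in both triangular solves as in the forcing passes. So
  a whole row can be subtracted, pivot term included, and every update is analysed by the same
  identity, \<open>row_apply_fun_upd\<close>.

  A uniform bound per row times the number of rows would lose the total \<open>m\<close>. Loop costs
  are therefore summed with a bound that depends on the iteration.

  There is no early exit: all divisors are non-zero even when the system has no solution, so the
  remaining passes run in any case and only a flag decides the answer.\<close>

definition runs :: "com \<Rightarrow> 'a::field state \<Rightarrow> nat \<Rightarrow> ('a state \<Rightarrow> bool) \<Rightarrow> bool" where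
  "runs c s T Q \<longleftrightarrow> (\<exists>t s'. exec c s t s' \<and> t \<le> T \<and> Q s')"

datatype loc = IV string | IA string | FV string | FA string

fun writes :: "com \<Rightarrow> loc set" where
  "writes Skip = {}"
| "writes (ISet x e) = {IV x}"
| "writes (IStore x e f) = {IA x}"
| "writes (FSet x e) = {FV x}"
| "writes (FStore x e f) = {FA x}"
| "writes (Seq c d) = writes c \<union> writes d"
| "writes (If b c d) = writes c \<union> writes d"
| "writes (While b c) = writes c"

text \<open>The frame condition. \<open>exec_unchanged\<close> reads it off from the syntax, and
  \<open>runs_weaken\<close> and \<open>runs_Seq\<close> hand it to their premises, so that a
  postcondition mentions only what a command is meant to change.\<close>

definition unchanged :: "loc set \<Rightarrow> 'a state \<Rightarrow> 'a state \<Rightarrow> bool" where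
  "unchanged W s s' \<longleftrightarrow>
     (\<forall>x. IV x \<notin> W \<longrightarrow> ivar s' x = ivar s x) \<and> (\<forall>x. IA x \<notin> W \<longrightarrow> iarr s' x = iarr s x) \<and>
     (\<forall>x. FV x \<notin> W \<longrightarrow> fvar s' x = fvar s x) \<and> (\<forall>x. FA x \<notin> W \<longrightarrow> farr s' x = farr s x)"

lemma unchanged_trans: "unchanged W s s' \<Longrightarrow> unchanged W s' s'' \<Longrightarrow> unchanged W s s''"
  by (simp add: unchanged_def)

lemma unchanged_mono: "unchanged W s s' \<Longrightarrow> W \<subseteq> W' \<Longrightarrow> unchanged W' s s'"
  unfolding unchanged_def by blast

lemma unchangedD:
  assumes "unchanged W s s'"
  shows "IV x \<notin> W \<Longrightarrow> ivar s' x = ivar s x" "IA x \<notin> W \<Longrightarrow> iarr s' x = iarr s x"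
    "FV x \<notin> W \<Longrightarrow> fvar s' x = fvar s x" "FA x \<notin> W \<Longrightarrow> farr s' x = farr s x"
  using assms by (simp_all add: unchanged_def)

lemma exec_unchanged: "exec c s t s' \<Longrightarrow> unchanged (writes c) s s'"
  by (induction rule: exec.induct) (auto simp: unchanged_def)

lemma runs_weaken:
  assumes "runs c s T Q" "T \<le> T'" "\<And>s'. unchanged (writes c) s s' \<Longrightarrow> Q s' \<Longrightarrow> Q' s'"
  shows "runs c s T' Q'"
  using assms exec_unchanged unfolding runs_def by (meson order_trans)

lemma runs_Seq:
  assumes "runs c s T1 R" "\<And>s'. unchanged (writes c) s s' \<Longrightarrow> R s' \<Longrightarrow> runs d s' T2 Q"
    "1 + T1 + T2 \<le> T"
  shows "runs (Seq c d) s T Q"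
proof -
  obtain t1 s1 where 1: "exec c s t1 s1" "t1 \<le> T1" "R s1"
    using assms(1) by (auto simp: runs_def)
  then obtain t2 s2 where 2: "exec d s1 t2 s2" "t2 \<le> T2" "Q s2"
    using assms(2) exec_unchanged unfolding runs_def by metis
  have "exec (Seq c d) s (1 + t1 + t2) s2"
    using 1 2 by (intro exec.Seq)
  moreover have "1 + t1 + t2 \<le> T"
    using 1 2 assms(3) by simp
  ultimately show ?thesis
    using 2 by (auto simp: runs_def)
qed

section \<open>Straight-line code as a function on states\<close>

fun loop_free :: "com \<Rightarrow> bool" where
  "loop_free (Seq c d) \<longleftrightarrow> loop_free c \<and> loop_free d"
| "loop_free (If b c d) \<longleftrightarrow> loop_free c \<and> loop_free d"
| "loop_free (While b c) \<longleftrightarrow> False"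
| "loop_free _ \<longleftrightarrow> True"

fun effect :: "com \<Rightarrow> 'a::field state \<Rightarrow> 'a state" where
  "effect Skip s = s"
| "effect (ISet x e) s = s\<lparr>ivar := (ivar s)(x := ival e s)\<rparr>"
| "effect (IStore x e f) s = s\<lparr>iarr := (iarr s)(x := (iarr s x)(ival e s := ival f s))\<rparr>"
| "effect (FSet x e) s = s\<lparr>fvar := (fvar s)(x := fval e s)\<rparr>"
| "effect (FStore x e f) s = s\<lparr>farr := (farr s)(x := (farr s x)(ival e s := fval f s))\<rparr>"
| "effect (Seq c d) s = effect d (effect c s)"
| "effect (If b c d) s = (if bval b s then effect c s else effect d s)"
| "effect (While b c) s = s"

fun legal :: "com \<Rightarrow> 'a::field state \<Rightarrow> bool" where
  "legal (FSet x e) s \<longleftrightarrow> fdefined e s"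
| "legal (FStore x e f) s \<longleftrightarrow> fdefined f s"
| "legal (Seq c d) s \<longleftrightarrow> legal c s \<and> legal d (effect c s)"
| "legal (If b c d) s \<longleftrightarrow> bdefined b s \<and> (if bval b s then legal c s else legal d s)"
| "legal _ s \<longleftrightarrow> True"

text \<open>For a conditional the costs of both branches are added: a bound for either branch
  suffices, and a sum evaluates without \<open>max\<close>.\<close>

fun max_cost :: "com \<Rightarrow> nat" where
  "max_cost Skip = 1"
| "max_cost (ISet x e) = 1 + icost e"
| "max_cost (IStore x e f) = 1 + icost e + icost f"
| "max_cost (FSet x e) = 1 + fcost e"
| "max_cost (FStore x e f) = 1 + icost e + fcost f"
| "max_cost (Seq c d) = 1 + max_cost c + max_cost d"
| "max_cost (If b c d) = 1 + bcost b + max_cost c + max_cost d"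
| "max_cost (While b c) = 0"

text \<open>Replaces the inductive semantics by functions that rewriting can evaluate. The risk of
  getting stuck at a division is confined to \<open>legal\<close>, which tests each expression in
  the state where it is reached.\<close>

lemma exec_loop_free:
  assumes "loop_free c" "legal c s"
  shows "\<exists>t \<le> max_cost c. exec c s t (effect c s)"
  using assms
proof (induction c arbitrary: s)
  case (Seq c d)
  obtain t1 where 1: "t1 \<le> max_cost c" "exec c s t1 (effect c s)"
    using Seq.IH(1)[of s] Seq.prems by auto
  obtain t2 where 2: "t2 \<le> max_cost d" "exec d (effect c s) t2 (effect d (effect c s))"
    using Seq.IH(2)[of "effect c s"] Seq.prems by auto
  show ?case
    by (rule exI[of _ "1 + t1 + t2"]) (use 1 2 exec.Seq in auto)
next
  case (If b c d)
  show ?case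
  proof (cases "bval b s")
    case True
    then obtain t1 where 1: "t1 \<le> max_cost c" "exec c s t1 (effect c s)"
      using If.IH(1)[of s] If.prems by auto
    show ?thesis
      by (rule exI[of _ "1 + bcost b + t1"]) (use 1 exec.IfTrue[of b s c] True If.prems in auto)
  next
    case False
    then obtain t1 where 1: "t1 \<le> max_cost d" "exec d s t1 (effect d s)"
      using If.IH(2)[of s] If.prems by auto
    show ?thesis
      by (rule exI[of _ "1 + bcost b + t1"]) (use 1 exec.IfFalse[of b s d] False If.prems in auto)
  qed
next
  case (FSet x e)
  then show ?case
    using exec.FSet[of e s x] by auto
next
  case (FStore x e f)
  then show ?case
    using exec.FStore[of f s x e] by auto
next
  case Skip
  show ?case using exec.Skip[of s] by auto
next
  case (ISet x e)
  show ?case using exec.ISet[of x e s] by auto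
next
  case (IStore x e f)
  show ?case using exec.IStore[of x e f s] by auto
qed simp

lemma runs_loop_free:
  assumes "loop_free c" "legal c s" "max_cost c \<le> T" "Q (effect c s)"
  shows "runs c s T Q"
  using exec_loop_free[OF assms(1,2)] assms(3,4) unfolding runs_def by (meson order_trans)

text \<open>The number \<open>M\<close> of iterations is fixed and the invariant carries the
  iteration number, so that the time bound \<open>T j\<close> may vary. The passes over sparse rows
  of different lengths need this.\<close>

lemma runs_While:
  assumes "I 0 s"
    and body: "\<And>j s'. j < M \<Longrightarrow> I j s' \<Longrightarrow> bdefined b s' \<and> bval b s' \<and> runs c s' (T j) (I (Suc j))"
    and stop: "\<And>s'. I M s' \<Longrightarrow> bdefined b s' \<and> \<not> bval b s'"
  shows "runs (While b c) s ((\<Sum>j<M. 1 + bcost b + T j) + (1 + bcost b)) (I M)"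
proof -
  \<comment> \<open>Generalised to the rest of the loop from iteration \<open>i\<close> on, and
    proved downwards from \<open>i = M\<close>, where the test fails.\<close>
  have "runs (While b c) s' ((\<Sum>j=i..<M. 1 + bcost b + T j) + (1 + bcost b)) (I M)"
    if "i \<le> M" "I i s'" for i s'
    using that
  proof (induction i arbitrary: s' rule: inc_induct)
    case base
    then show ?case
      using exec.WhileFalse[of b s' c] stop[of s'] unfolding runs_def by fastforce
  next
    case (step i)
    obtain t1 s1 where 1: "exec c s' t1 s1" "t1 \<le> T i" "I (Suc i) s1"
      using body[OF step.hyps(2) step.prems] by (auto simp: runs_def)
    obtain t2 s2 where 2: "exec (While b c) s1 t2 s2" "I M s2"
      "t2 \<le> (\<Sum>j=Suc i..<M. 1 + bcost b + T j) + (1 + bcost b)"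
      using step.IH[OF 1(3)] by (auto simp: runs_def)
    have "exec (While b c) s' (1 + bcost b + t1 + t2) s2"
      using body[OF step.hyps(2) step.prems] 1 2 by (intro exec.WhileTrue) auto
    moreover have "1 + bcost b + t1 + t2 \<le> (\<Sum>j=i..<M. 1 + bcost b + T j) + (1 + bcost b)"
      using 1 2 step.hyps by (simp add: sum.atLeast_Suc_lessThan)
    ultimately show ?case
      using 2(2) unfolding runs_def by blast
  qed
  from this[of 0 s] show ?thesis
    using assms(1) by (simp add: atLeast0LessThan)
qed

abbreviation seti :: "string \<Rightarrow> nat \<Rightarrow> 'a state \<Rightarrow> 'a state" where
  "seti x v s \<equiv> s\<lparr>ivar := (ivar s)(x := v)\<rparr>"

definition For :: "string \<Rightarrow> string \<Rightarrow> com \<Rightarrow> com" where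
  "For x y c = Seq (ISet x (N 0)) (While (ILess (IVar x) (IVar y)) (Seq c (ISet x (Succ (IVar x)))))"

lemma writes_For [simp]: "writes (For x y c) = insert (IV x) (writes c)"
  by (auto simp: For_def)

text \<open>The assumption \<open>stable\<close> says that the invariant does not look at the
  counter, so it survives initialisation and increment. The body may use that everything outside the
  write set of the loop has its value from before the loop.\<close>

lemma runs_For:
  fixes s :: "'a::field state"
  assumes xy: "x \<noteq> y" "IV x \<notin> writes c" "IV y \<notin> writes c"
    and init: "I 0 s"
    and stable: "\<And>j s v. I j (seti x v s) \<longleftrightarrow> I j s"
    and body: "\<And>j s'. j < ivar s y \<Longrightarrow> unchanged (writes (For x y c)) s s' \<Longrightarrow> ivar s' x = j \<Longrightarrow>
      I j s' \<Longrightarrow> runs c s' (T j) (I (Suc j))"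
    and time: "(\<Sum>j<ivar s y. T j) + 10 * ivar s y + 10 \<le> T'"
  shows "runs (For x y c) s T' (I (ivar s y))"
proof -
  define W where "W = writes (For x y c)"
  let ?N = "ivar s y"
  \<comment> \<open>Adds to \<open>I\<close> the value of the counter and the frame relative to the
    state before the loop; the latter keeps the bound \<open>ivar s y\<close> constant.\<close>
  define J where "J j s' \<longleftrightarrow> unchanged W s s' \<and> ivar s' x = j \<and> I j s'" for j s'
  let ?b = "ILess (IVar x) (IVar y)" and ?c = "Seq c (ISet x (Succ (IVar x)))"
  have y: "ivar s' y = ?N" if "J j s'" for j s'
    using that xy by (auto simp: J_def W_def unchanged_def)
  have 1: "runs (While ?b ?c) (seti x 0 s) ((\<Sum>j<?N. 1 + bcost ?b + (T j + 4)) + (1 + bcost ?b)) (J ?N)"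
  proof (rule runs_While)
    show "J 0 (seti x 0 s)"
      using init by (auto simp: J_def stable W_def unchanged_def)
  next
    fix j s' assume j: "j < ?N" "J j s'"
    have "runs ?c s' (T j + 4) (J (Suc j))"
    proof (rule runs_Seq)
      show "runs c s' (T j) (I (Suc j))"
        using j body by (auto simp: J_def W_def)
    next
      fix s1 assume s1: "unchanged (writes c) s' s1" "I (Suc j) s1"
      have "unchanged W s s1"
        using j unchanged_mono[OF s1(1), of W] unchanged_trans by (auto simp: J_def W_def)
      moreover have "ivar s1 x = j"
        using j xy unchangedD(1)[OF s1(1)] by (simp add: J_def)
      ultimately show "runs (ISet x (Succ (IVar x))) s1 3 (J (Suc j))"
        using s1 xy by (intro runs_loop_free) (auto simp: J_def stable W_def unchanged_def)
    qed simp
    then show "bdefined ?b s' \<and> bval ?b s' \<and> runs ?c s' (T j + 4) (J (Suc j))"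
      using j y[OF j(2)] by (simp add: J_def)
  next
    fix s' assume "J ?N s'"
    then show "bdefined ?b s' \<and> \<not> bval ?b s'"
      using y by (simp add: J_def)
  qed
  \<comment> \<open>Test, sequencing and increment cost 8 per iteration, initialisation and the last
    test cost 7 altogether; both are rounded up to 10.\<close>
  have "runs (For x y c) s T' (J ?N)"
    unfolding For_def
    by (rule runs_Seq[where R = "\<lambda>s'. s' = seti x 0 s" and ?T1.0 = 2])
      (use time 1 in \<open>auto intro!: runs_loop_free simp: sum.distrib\<close>)
  then show ?thesis
    by (rule runs_weaken) (auto simp: J_def)
qed

section \<open>Reduction to the core system\<close>

lemma sum_mult_fun_upd:
  fixes a x :: "nat \<Rightarrow> 'a::field"
  assumes "u < n"
  shows "(\<Sum>j<n. a j * (x(u := v)) j) = (\<Sum>j<n. a j * x j) + a u * (v - x u)"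
proof -
  have "(\<Sum>j<n. a j * (x(u := v)) j) = (\<Sum>j<n. a j * x j + (if j = u then a u * (v - x u) else 0))"
    by (intro sum.cong) (auto simp: algebra_simps)
  then show ?thesis
    using assms by (simp add: sum.distrib)
qed

text \<open>Stated for functions instead of vectors because the arrays of the machine are functions
  on the naturals; only indices below \<open>dim_col A\<close> matter.\<close>

definition row_apply :: "'a::field mat \<Rightarrow> (nat \<Rightarrow> 'a) \<Rightarrow> nat \<Rightarrow> 'a" where
  "row_apply A x i = (\<Sum>j<dim_col A. A $$ (i, j) * x j)"

lemma row_apply_fun_upd:
  "u < dim_col A \<Longrightarrow> row_apply A (x(u := v)) i = row_apply A x i + A $$ (i, u) * (v - x u)"
  unfolding row_apply_def by (rule sum_mult_fun_upd)

lemma row_apply_cong: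
  "(\<And>j. j < dim_col A \<Longrightarrow> A $$ (i, j) \<noteq> 0 \<Longrightarrow> x j = y j) \<Longrightarrow> row_apply A x i = row_apply A y i"
  unfolding row_apply_def by (intro sum.cong) auto

lemma row_scalar_prod:
  "i < dim_row A \<Longrightarrow> dim_vec v = dim_col A \<Longrightarrow> row A i \<bullet> v = row_apply A (\<lambda>j. v $ j) i"
  by (simp add: scalar_prod_def row_apply_def atLeast0LessThan)

lemma mult_mat_vec_index:
  "i < dim_row A \<Longrightarrow> dim_vec v = dim_col A \<Longrightarrow> (A *\<^sub>v v) $ i = row_apply A (\<lambda>j. v $ j) i"
  by (simp add: row_scalar_prod)

text \<open>The assignments of \<open>Forcing\<close>, started from an arbitrary vector instead of zero.\<close>

definition assign :: "'a::field mat \<Rightarrow> (nat \<Rightarrow> 'a) \<Rightarrow> (nat \<Rightarrow> 'a) \<Rightarrow> nat \<times> nat \<Rightarrow> nat \<Rightarrow> 'a" where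
  "assign A b x f = x(fst f := (b (snd f) - row_apply A x (snd f)) / A $$ (snd f, fst f))"

locale zero_forcing_system =
  fixes n :: nat and A :: "'a::field mat" and zs :: "nat list" and \<pi> :: "(nat \<times> nat) list"
  assumes A: "A \<in> carrier_mat n n"
    and zs: "distinct zs" "set zs \<subseteq> {..<n}"
    and \<pi>: "chronological_list A (set zs) \<pi>"
begin

lemma dims [simp]: "dim_row A = n" "dim_col A = n"
  using A by auto

section \<open>Triangular structure of the parent equations\<close>

definition blue :: "nat \<Rightarrow> nat set" where
  "blue i = set zs \<union> set (map fst (take i \<pi>))"

lemma blue_0: "blue 0 = set zs"
  by (simp add: blue_def)

lemma blue_Suc: "i < length \<pi> \<Longrightarrow> blue (Suc i) = insert (fst (\<pi> ! i)) (blue i)"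
  by (auto simp: blue_def take_Suc_conv_app_nth)

lemma blue_length: "blue (length \<pi>) = {..<n}"
  using \<pi> zs by (auto simp: blue_def chronological_list_def)

lemma blue_mono: "i \<le> j \<Longrightarrow> blue i \<subseteq> blue j"
  using set_take_subset_set_take[of i j \<pi>] by (auto simp: blue_def)

lemma forces_nth: "i < length \<pi> \<Longrightarrow> forces A (blue i) (snd (\<pi> ! i)) (fst (\<pi> ! i))"
  using \<pi> by (simp add: chronological_list_def blue_def)

lemma forced_less: "i < length \<pi> \<Longrightarrow> fst (\<pi> ! i) < n"
  and forced_notin_Z: "i < length \<pi> \<Longrightarrow> fst (\<pi> ! i) \<notin> set zs"
proof -
  have "i < length \<pi> \<Longrightarrow> fst (\<pi> ! i) \<in> {..<n} - set zs"
    using \<pi> nth_mem[of i "map fst \<pi>"] by (auto simp: chronological_list_def)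
  then show "i < length \<pi> \<Longrightarrow> fst (\<pi> ! i) < n" "i < length \<pi> \<Longrightarrow> fst (\<pi> ! i) \<notin> set zs"
    by auto
qed

lemma parent_less: "i < length \<pi> \<Longrightarrow> snd (\<pi> ! i) < n"
  and pivot_nonzero: "i < length \<pi> \<Longrightarrow> A $$ (snd (\<pi> ! i), fst (\<pi> ! i)) \<noteq> 0"
  and parent_blue: "i < length \<pi> \<Longrightarrow> snd (\<pi> ! i) \<in> blue i"
  and forced_not_blue: "i < length \<pi> \<Longrightarrow> fst (\<pi> ! i) \<notin> blue i"
  using forces_nth[of i] by (auto simp: forces_def out_neighbours_def edges_def)

text \<open>This is triangularity: in the order of \<pi>, equation \<open>i\<close> involves only
  blue vertices and the vertex being forced. A diagonal entry is not an edge, so it is treated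
  separately; there the parent itself is blue.\<close>

lemma parent_row_support:
  assumes "i < length \<pi>" "v < n" "A $$ (snd (\<pi> ! i), v) \<noteq> 0"
  shows "v \<in> blue (Suc i)"
  using assms forces_nth[of i] parent_less[of i] parent_blue[of i]
  by (cases "v = snd (\<pi> ! i)") (auto simp: forces_def out_neighbours_def edges_def blue_Suc)

text \<open>After a vertex has forced, the whole support of its row is blue, so it has no non-blue
  out-neighbour left to force.\<close>

lemma distinct_parents: "distinct (map snd \<pi>)"
proof -
  have "snd (\<pi> ! i) \<noteq> snd (\<pi> ! j)" if "i < j" "j < length \<pi>" for i j
  proof
    assume eq: "snd (\<pi> ! i) = snd (\<pi> ! j)"
    have "fst (\<pi> ! j) \<in> blue (Suc i)"
      using parent_row_support[of i "fst (\<pi> ! j)"] that pivot_nonzero[of j] forced_less[of j] eq by auto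
    then show False
      using blue_mono[of "Suc i" j] forced_not_blue[of j] that by auto
  qed
  then show ?thesis
    unfolding distinct_conv_nth by (metis length_map nat_neq_iff nth_map)
qed

lemma length_\<pi>: "length \<pi> + length zs = n"
proof -
  have "length \<pi> = card ({..<n} - set zs)"
    using \<pi> distinct_card[of "map fst \<pi>"] by (simp add: chronological_list_def)
  also have "\<dots> = n - length zs"
    using zs by (simp add: card_Diff_subset distinct_card)
  finally show ?thesis
    using zs card_mono[of "{..<n}" "set zs"] by (simp add: distinct_card)
qed

lemma parents_subset: "set (map snd \<pi>) \<subseteq> {..<n}"
  using parent_less by (auto simp: set_conv_nth)

text \<open>There are as many parents as forces, since parents are distinct. This makes the core
  matrix square.\<close>

lemma length_terminals:
  assumes "distinct ts" "set ts = terminals A \<pi>"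
  shows "length ts = length zs"
proof -
  have "length ts = card ({..<n} - set (map snd \<pi>))"
    using assms distinct_card[of ts] by (simp add: terminals_def)
  also have "\<dots> = n - length \<pi>"
    using parents_subset distinct_card[OF distinct_parents]
    by (subst card_Diff_subset) auto
  finally show ?thesis
    using length_\<pi> by simp
qed

section \<open>Existence and uniqueness for the parent equations\<close>

definition satisfies :: "(nat \<Rightarrow> 'a) \<Rightarrow> (nat \<Rightarrow> 'a) \<Rightarrow> bool" where
  "satisfies b x \<longleftrightarrow> (\<forall>i < length \<pi>. row_apply A x (snd (\<pi> ! i)) = b (snd (\<pi> ! i)))"

text \<open>Existence, by substitution in the order of \<pi>. The start vector must vanish outside
  \<open>set zs\<close> because \<open>assign\<close> subtracts the complete row of the parent,
  including the coordinate about to be set.\<close>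

lemma satisfies_assign:
  fixes b x0 :: "nat \<Rightarrow> 'a"
  assumes "\<And>v. v < n \<Longrightarrow> v \<notin> set zs \<Longrightarrow> x0 v = 0"
  defines "x \<equiv> foldl (assign A b) x0 \<pi>"
  shows "satisfies b x" "\<And>v. v \<in> set zs \<Longrightarrow> x v = x0 v"
proof -
  have "(\<forall>v \<in> set zs. foldl (assign A b) x0 (take i \<pi>) v = x0 v) \<and>
     (\<forall>v < n. v \<notin> blue i \<longrightarrow> foldl (assign A b) x0 (take i \<pi>) v = 0) \<and>
     (\<forall>j < i. row_apply A (foldl (assign A b) x0 (take i \<pi>)) (snd (\<pi> ! j)) = b (snd (\<pi> ! j)))"
    if "i \<le> length \<pi>" for i
    using that
  proof (induction i)
    case 0
    then show ?case
      using assms by (simp add: blue_0)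
  next
    case (Suc i)
    define y where "y = foldl (assign A b) x0 (take i \<pi>)"
    let ?u = "fst (\<pi> ! i)" and ?p = "snd (\<pi> ! i)"
    have i: "i < length \<pi>"
      using Suc by simp
    have y': "foldl (assign A b) x0 (take (Suc i) \<pi>) = y(?u := (b ?p - row_apply A y ?p) / A $$ (?p, ?u))"
      using i by (simp add: take_Suc_conv_app_nth y_def assign_def)
    have y: "\<forall>v \<in> set zs. y v = x0 v" "\<forall>v < n. v \<notin> blue i \<longrightarrow> y v = 0"
      "\<forall>j < i. row_apply A y (snd (\<pi> ! j)) = b (snd (\<pi> ! j))"
      using Suc i by (auto simp: y_def)
    \<comment> \<open>The vertex set now is not yet blue, so by \<open>parent_row_support\<close> it
      is absent from all earlier parent rows, and their equations stay valid.\<close>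
    have old: "A $$ (snd (\<pi> ! j), ?u) = 0" if "j < i" for j
      using parent_row_support[of j ?u] forced_less[of i] blue_mono[of "Suc j" i] forced_not_blue[of i]
        that i by auto
    \<comment> \<open>The old value at \<open>?u\<close> is 0, so the assigned value is the whole
      change.\<close>
    have upd: "row_apply A (y(?u := c)) p = row_apply A y p + A $$ (p, ?u) * c" for c p
      using y(2) forced_less[OF i] forced_not_blue[OF i] row_apply_fun_upd[of ?u A y c p] by simp
    show ?case
      unfolding y'
    proof (intro conjI ballI allI impI)
      fix j assume "j < Suc i"
      then show "row_apply A (y(?u := (b ?p - row_apply A y ?p) / A $$ (?p, ?u))) (snd (\<pi> ! j)) = b (snd (\<pi> ! j))"
        unfolding upd using y(3) old pivot_nonzero[OF i] by (cases "j = i") simp_all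
    qed (use y forced_notin_Z[OF i] in \<open>auto simp: blue_Suc[OF i]\<close>)
  qed
  from this[of "length \<pi>"] show "satisfies b x" "\<And>v. v \<in> set zs \<Longrightarrow> x v = x0 v"
    by (auto simp: satisfies_def x_def)
qed

text \<open>Uniqueness, in the form needed for a difference of solutions: zeros spread along the
  forces, since each parent row has only its pivot coordinate left.\<close>

lemma satisfies_zero:
  assumes "satisfies (\<lambda>_. 0) d" "\<And>v. v \<in> set zs \<Longrightarrow> d v = 0" "v < n"
  shows "d v = 0"
proof -
  have "\<forall>v \<in> blue i. d v = 0" if "i \<le> length \<pi>" for i
    using that
  proof (induction i)
    case 0
    then show ?case
      using assms by (simp add: blue_0)
  next
    case (Suc i)
    let ?u = "fst (\<pi> ! i)" and ?p = "snd (\<pi> ! i)"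
    have i: "i < length \<pi>"
      using Suc by simp
    \<comment> \<open>All coordinates in the support of this row except \<open>?u\<close> are
      already known to be 0.\<close>
    have "row_apply A d ?p = row_apply A ((\<lambda>_. 0)(?u := d ?u)) ?p"
    proof (rule row_apply_cong)
      fix v assume "v < dim_col A" "A $$ (?p, v) \<noteq> 0"
      then show "d v = ((\<lambda>_. 0)(?u := d ?u)) v"
        using parent_row_support[OF i, of v] Suc i by (auto simp: blue_Suc)
    qed
    also have "\<dots> = A $$ (?p, ?u) * d ?u"
      using forced_less[OF i] by (simp add: row_apply_fun_upd) (simp add: row_apply_def)
    finally have "d ?u = 0"
      using assms(1) i pivot_nonzero[OF i] by (simp add: satisfies_def)
    then show ?case
      using Suc i by (simp add: blue_Suc)
  qed
  from this[of "length \<pi>"] show ?thesis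
    using assms(3) by (simp add: blue_length)
qed

section \<open>Agreement with \<open>Forcing\<close> and the residual\<close>

lemma foldl_assign_cong:
  assumes "\<And>v. v < n \<Longrightarrow> y v = y' v" "v < n"
  shows "foldl (assign A b) y fs v = foldl (assign A b) y' fs v"
  using assms
proof (induction fs arbitrary: y y')
  case (Cons f fs)
  have "row_apply A y p = row_apply A y' p" for p
    using Cons.prems by (intro row_apply_cong) auto
  then show ?case
    unfolding foldl_Cons using Cons.prems by (intro Cons.IH) (auto simp: assign_def)
qed simp

text \<open>Bridges vectors and functions, which can be compared only below \<open>n\<close>; the
  assumption on \<open>fs\<close> keeps the updated indices and the rows in range.\<close>

lemma foldl_update_vec:
  assumes "dim_vec x = n" "set fs \<subseteq> set \<pi>" "v < n"
  shows "foldl (\<lambda>x (u, p). update_vec x u ((b $ p - row A p \<bullet> x) / A $$ (p, u))) x fs $ v =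
     foldl (assign A (\<lambda>i. b $ i)) (\<lambda>i. x $ i) fs v"
    (is "?F x fs $ v = _")
proof -
  show ?thesis
    using assms
  proof (induction fs arbitrary: x)
    case (Cons f fs)
    obtain u p where f: "f = (u, p)"
      by (cases f)
    have u: "u < n" "p < n"
      using Cons.prems f forced_less parent_less by (fastforce simp: in_set_conv_nth)+
    let ?x = "update_vec x u ((b $ p - row A p \<bullet> x) / A $$ (p, u))"
    have x: "?x $ v = assign A (\<lambda>i. b $ i) (\<lambda>i. x $ i) f v" if "v < n" for v
      using that Cons.prems u by (cases "v = u") (simp_all add: assign_def f row_scalar_prod)
    have "?F ?x fs $ v = foldl (assign A (\<lambda>i. b $ i)) (\<lambda>i. ?x $ i) fs v"
      using Cons.prems by (intro Cons.IH) auto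
    also have "\<dots> = foldl (assign A (\<lambda>i. b $ i)) (assign A (\<lambda>i. b $ i) (\<lambda>i. x $ i) f) fs v"
      using x Cons.prems by (intro foldl_assign_cong) auto
    finally show ?case
      by (simp add: f)
  qed simp
qed

lemma dim_Forcing [simp]: "dim_vec (Forcing A \<pi> b) = n"
proof -
  have "dim_vec (foldl (\<lambda>x (u, p). update_vec x u ((b $ p - row A p \<bullet> x) / A $$ (p, u))) x fs) = dim_vec x"
    for x fs
    by (induction fs arbitrary: x) (auto split: prod.splits)
  then show ?thesis
    by (simp add: Forcing_def)
qed

lemma Forcing_index:
  "v < n \<Longrightarrow> Forcing A \<pi> b $ v = foldl (assign A (\<lambda>i. b $ i)) (\<lambda>_. 0) \<pi> v"
proof -
  assume "v < n"
  then show ?thesis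
    unfolding Forcing_def by (subst foldl_update_vec) (auto intro: foldl_assign_cong)
qed

lemma Forcing_satisfies: "satisfies (\<lambda>i. b $ i) (\<lambda>i. Forcing A \<pi> b $ i)"
  and Forcing_zero: "v \<in> set zs \<Longrightarrow> Forcing A \<pi> b $ v = 0"
proof -
  have "row_apply A (\<lambda>i. Forcing A \<pi> b $ i) p = row_apply A (foldl (assign A (\<lambda>i. b $ i)) (\<lambda>_. 0) \<pi>) p" for p
    by (intro row_apply_cong) (simp add: Forcing_index)
  then show "satisfies (\<lambda>i. b $ i) (\<lambda>i. Forcing A \<pi> b $ i)"
    using satisfies_assign(1)[of "\<lambda>_. 0" "\<lambda>i. b $ i"] by (simp add: satisfies_def)
  show "v \<in> set zs \<Longrightarrow> Forcing A \<pi> b $ v = 0"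
    using satisfies_assign(2)[of "\<lambda>_. 0" v "\<lambda>i. b $ i"] zs by (auto simp: Forcing_index)
qed

lemma residual_index:
  "t < n \<Longrightarrow> dim_vec b = n \<Longrightarrow> residual A \<pi> b $ t = b $ t - row_apply A (\<lambda>i. Forcing A \<pi> b $ i) t"
  by (simp add: residual_def row_scalar_prod)

text \<open>The vectors \<open>e j - ?y j\<close> satisfy the homogeneous parent equations, because
  forcing from column \<open>zs ! j\<close> reproduces this column in all parent rows, and on
  \<open>set zs\<close> they agree with \<open>e j\<close>. By uniqueness \<open>x\<close> is
  \<open>Forcing A \<pi> b\<close> plus their combination with coefficients
  \<open>x (zs ! j)\<close>. The terminal rows of \<open>A\<close> map \<open>e j - ?y j\<close> to
  column \<open>j\<close> of the core matrix.\<close>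

lemma defect_on_terminals:
  assumes x: "satisfies (\<lambda>i. b $ i) x" and b: "b \<in> carrier_vec n"
    and ts: "set ts = terminals A \<pi>" and i: "i < length ts"
  shows "b $ (ts ! i) - row_apply A x (ts ! i) =
    residual A \<pi> b $ (ts ! i) - row_apply (core_matrix A \<pi> ts zs) (\<lambda>j. x (zs ! j)) i"
proof -
  let ?k = "length zs"
  let ?y = "\<lambda>j i. Forcing A \<pi> (col A (zs ! j)) $ i"
  define e where "e j v = (if v = zs ! j then 1 else 0 :: 'a)" for j v
  \<comment> \<open>The difference between \<open>x\<close> and that affine expression; it is shown
    to vanish below \<open>n\<close>.\<close>
  define d where "d v = x v - Forcing A \<pi> b $ v - (\<Sum>j<?k. x (zs ! j) * (e j v - ?y j v))" for v
  have zs_less: "zs ! j < n" if "j < ?k" for j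
    using zs that nth_mem by blast
  have row: "row_apply A d p = row_apply A x p - row_apply A (\<lambda>i. Forcing A \<pi> b $ i) p -
      (\<Sum>j<?k. x (zs ! j) * (A $$ (p, zs ! j) - row_apply A (?y j) p))" for p
  proof -
    have e: "(\<Sum>v<n. A $$ (p, v) * e j v) = A $$ (p, zs ! j)" if "j < ?k" for j
    proof -
      have "(\<Sum>v<n. A $$ (p, v) * e j v) = (\<Sum>v<n. if v = zs ! j then A $$ (p, v) else 0)"
        by (intro sum.cong) (auto simp: e_def)
      then show ?thesis
        using zs_less[OF that] by simp
    qed
    have "row_apply A d p = (\<Sum>v<n. A $$ (p, v) * x v) - (\<Sum>v<n. A $$ (p, v) * Forcing A \<pi> b $ v) -
        (\<Sum>v<n. \<Sum>j<?k. A $$ (p, v) * (x (zs ! j) * (e j v - ?y j v)))"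
      by (simp add: row_apply_def d_def right_diff_distrib sum_subtractf sum_distrib_left)
    also have "(\<Sum>v<n. \<Sum>j<?k. A $$ (p, v) * (x (zs ! j) * (e j v - ?y j v))) =
        (\<Sum>j<?k. \<Sum>v<n. x (zs ! j) * (A $$ (p, v) * e j v - A $$ (p, v) * ?y j v))"
      by (subst sum.swap) (simp add: algebra_simps)
    also have "\<dots> = (\<Sum>j<?k. x (zs ! j) * (A $$ (p, zs ! j) - row_apply A (?y j) p))"
      by (intro sum.cong) (simp_all add: sum_distrib_left[symmetric] sum_subtractf e row_apply_def)
    finally show ?thesis
      by (simp add: row_apply_def)
  qed
  have "satisfies (\<lambda>_. 0) d"
    unfolding satisfies_def
  proof (intro allI impI)
    fix i assume i: "i < length \<pi>"
    have "row_apply A (?y j) (snd (\<pi> ! i)) = A $$ (snd (\<pi> ! i), zs ! j)" if "j < ?k" for j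
      using Forcing_satisfies[of "col A (zs ! j)"] i zs_less[OF that] parent_less[OF i]
      by (simp add: satisfies_def)
    then show "row_apply A d (snd (\<pi> ! i)) = 0"
      using x Forcing_satisfies[of b] i by (simp add: row satisfies_def)
  qed
  moreover have "d v = 0" if v: "v \<in> set zs" for v
  proof -
    obtain l where l: "l < ?k" "v = zs ! l"
      using v by (auto simp: in_set_conv_nth)
    \<comment> \<open>\<open>Forcing\<close> vanishes on \<open>set zs\<close>, so only the unit
      vector at \<open>v\<close> itself contributes.\<close>
    have "(\<Sum>j<?k. x (zs ! j) * (e j v - ?y j v)) = (\<Sum>j<?k. if j = l then x v else 0)"
      using l zs by (intro sum.cong) (auto simp: Forcing_zero e_def nth_eq_iff_index_eq)
    then show ?thesis
      using l by (simp add: d_def Forcing_zero)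
  qed
  ultimately have "d v = 0" if "v < n" for v
    using satisfies_zero that by blast
  \<comment> \<open>In a terminal row the vanishing of \<open>d\<close> is the claim up to
    rearrangement.\<close>
  then have d: "row_apply A d (ts ! i) = 0"
    by (simp add: row_apply_def)
  have t: "ts ! i < n"
    using ts nth_mem[OF i] by (auto simp: terminals_def)
  have core: "dim_col (core_matrix A \<pi> ts zs) = ?k"
    "\<And>j. j < ?k \<Longrightarrow> core_matrix A \<pi> ts zs $$ (i, j) = A $$ (ts ! i, zs ! j) - row_apply A (?y j) (ts ! i)"
    using i t zs_less by (simp_all add: core_matrix_def residual_index)
  have "row_apply (core_matrix A \<pi> ts zs) (\<lambda>j. x (zs ! j)) i =
      (\<Sum>j<?k. x (zs ! j) * (A $$ (ts ! i, zs ! j) - row_apply A (?y j) (ts ! i)))"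
    unfolding row_apply_def[of "core_matrix A \<pi> ts zs"] core(1)
    by (intro sum.cong) (simp_all add: core(2))
  also have "\<dots> = row_apply A x (ts ! i) - row_apply A (\<lambda>i. Forcing A \<pi> b $ i) (ts ! i)"
    using d unfolding row by simp
  finally show ?thesis
    using residual_index[OF t] b by simp
qed

text \<open>Parents and terminals partition the rows. Once the parent rows hold, the defect in a
  terminal row is the difference of the two sides of the core equation.\<close>

lemma solves_iff:
  assumes b: "b \<in> carrier_vec n" and x: "x \<in> carrier_vec n" and ts: "set ts = terminals A \<pi>"
  shows "A *\<^sub>v x = b \<longleftrightarrow> satisfies (\<lambda>i. b $ i) (\<lambda>i. x $ i) \<and>
    (\<forall>i < length ts. row_apply (core_matrix A \<pi> ts zs) (\<lambda>j. x $ (zs ! j)) i = residual A \<pi> b $ (ts ! i))"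
proof -
  have "A *\<^sub>v x = b \<longleftrightarrow> (\<forall>i < n. row_apply A (\<lambda>j. x $ j) i = b $ i)"
  proof
    show "A *\<^sub>v x = b \<Longrightarrow> \<forall>i < n. row_apply A (\<lambda>j. x $ j) i = b $ i"
      using x by (metis carrier_vecD dims mult_mat_vec_index)
    show "\<forall>i < n. row_apply A (\<lambda>j. x $ j) i = b $ i \<Longrightarrow> A *\<^sub>v x = b"
      using b x by (intro eq_vecI) (auto simp: row_scalar_prod)
  qed
  also have "\<dots> \<longleftrightarrow> satisfies (\<lambda>i. b $ i) (\<lambda>i. x $ i) \<and>
    (\<forall>i < length ts. row_apply A (\<lambda>j. x $ j) (ts ! i) = b $ (ts ! i))"
  proof -
    have "{..<n} = set (map snd \<pi>) \<union> set ts"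
      using ts parents_subset by (auto simp: terminals_def)
    then have "(\<forall>i < n. Q i) \<longleftrightarrow> (\<forall>i < length \<pi>. Q (snd (\<pi> ! i))) \<and> (\<forall>i < length ts. Q (ts ! i))" for Q
    proof -
      have "(\<forall>i < n. Q i) \<longleftrightarrow> (\<forall>i \<in> {..<n}. Q i)"
        by auto
      also have "\<dots> \<longleftrightarrow> (\<forall>i < length \<pi>. Q (snd (\<pi> ! i))) \<and> (\<forall>i < length ts. Q (ts ! i))"
        unfolding \<open>{..<n} = _\<close> ball_Un all_set_conv_all_nth by simp
      finally show ?thesis .
    qed
    then show ?thesis
      by (simp add: satisfies_def)
  qed
  also have "\<dots> \<longleftrightarrow> satisfies (\<lambda>i. b $ i) (\<lambda>i. x $ i) \<and>
    (\<forall>i < length ts. row_apply (core_matrix A \<pi> ts zs) (\<lambda>j. x $ (zs ! j)) i = residual A \<pi> b $ (ts ! i))"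
  proof (intro conj_cong refl all_cong)
    fix i assume "satisfies (\<lambda>i. b $ i) (\<lambda>i. x $ i)" "i < length ts"
    from defect_on_terminals[OF this(1) b ts this(2)]
    show "row_apply A (\<lambda>j. x $ j) (ts ! i) = b $ (ts ! i) \<longleftrightarrow>
      row_apply (core_matrix A \<pi> ts zs) (\<lambda>j. x $ (zs ! j)) i = residual A \<pi> b $ (ts ! i)"
      by (metis eq_iff_diff_eq_0)
  qed
  finally show ?thesis .
qed

end

section \<open>Solving with an LSP decomposition\<close>

text \<open>Strong induction: in row \<open>i\<close> the terms left of the diagonal vanish by
  induction, those right of it by triangularity, and the diagonal entry is 1.\<close>

lemma unit_lower_triangular_inj:
  fixes L :: "'a::field mat"
  assumes L: "L \<in> carrier_mat k k" "\<And>i. i < k \<Longrightarrow> L $$ (i, i) = 1"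
    "\<And>i j. i < j \<Longrightarrow> j < k \<Longrightarrow> L $$ (i, j) = 0"
    and eq: "\<And>i. i < k \<Longrightarrow> row_apply L x i = row_apply L y i" and "i < k"
  shows "x i = y i"
  using \<open>i < k\<close>
proof (induction i rule: less_induct)
  case (less i)
  have "L $$ (i, j) * (x j - y j) = (if j = i then x i - y i else 0)" if "j < k" for j
    using less L that by (cases i j rule: linorder_cases) auto
  then have "(\<Sum>j<k. L $$ (i, j) * (x j - y j)) = x i - y i"
    using less by simp
  then show ?case
    using eq[OF less.prems] L(1) by (simp add: row_apply_def right_diff_distrib sum_subtractf)
qed

text \<open>The bound \<open>i\<close> makes the prefixes available for a loop invariant: this is
  what the forward pass has collected after \<open>i\<close> rows.\<close>

definition nonzero_rows :: "'a::zero mat \<Rightarrow> nat \<Rightarrow> nat list" where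
  "nonzero_rows S i = filter (\<lambda>i. \<exists>j < dim_col S. S $$ (i, j) \<noteq> 0) [0..<i]"

lemma delete_zero_rows_conv:
  "delete_zero_rows S = mat_of_rows (dim_col S) (map (row S) (nonzero_rows S (dim_row S)))"
proof -
  have "filter (\<lambda>i. row S i \<noteq> 0\<^sub>v (dim_col S)) [0..<dim_row S] = nonzero_rows S (dim_row S)"
    unfolding nonzero_rows_def by (intro filter_cong refl) (auto simp: vec_eq_iff)
  then show ?thesis
    by (simp add: delete_zero_rows_def rows_def filter_map o_def)
qed

locale LSP_decomposition =
  fixes k :: nat and B L S P :: "'a::field mat" and \<sigma> :: "nat \<Rightarrow> nat"
  assumes B: "B \<in> carrier_mat k k"
    and LSP: "is_LSP B L S P"
    and \<sigma>: "\<sigma> permutes {..<k}" "P = mat k k (\<lambda>(i, j). if j = \<sigma> i then 1 else 0)"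
begin

lemma carriers: "L \<in> carrier_mat k k" "S \<in> carrier_mat k k" "P \<in> carrier_mat k k"
  using B LSP by (auto simp: is_LSP_def)

lemma LSP_dims [simp]: "dim_row B = k" "dim_col B = k" "dim_row L = k" "dim_col L = k"
  "dim_row S = k" "dim_col S = k" "dim_row P = k" "dim_col P = k"
  using B carriers by auto

lemma L_diag: "i < k \<Longrightarrow> L $$ (i, i) = 1"
  and L_upper: "i < j \<Longrightarrow> j < k \<Longrightarrow> L $$ (i, j) = 0"
  using LSP by (auto simp: is_LSP_def)

lemma \<sigma>_less: "i < k \<Longrightarrow> \<sigma> i < k"
  using permutes_in_image[OF \<sigma>(1), of i] by simp

lemma \<sigma>_eq_iff: "\<sigma> i = \<sigma> j \<longleftrightarrow> i = j"
  using permutes_inj[OF \<sigma>(1)] by (simp add: inj_eq)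

lemma P_index: "i < k \<Longrightarrow> j < k \<Longrightarrow> P $$ (i, j) = (if j = \<sigma> i then 1 else 0)"
  by (simp add: \<sigma>(2))

lemma row_apply_P: "i < k \<Longrightarrow> row_apply P z i = z (\<sigma> i)"
proof -
  assume i: "i < k"
  have "row_apply P z i = (\<Sum>j<k. if j = \<sigma> i then z (\<sigma> i) else 0)"
    unfolding row_apply_def using i by (intro sum.cong) (auto simp: P_index)
  then show ?thesis
    using \<sigma>_less[OF i] by simp
qed

text \<open>Lets the core system be solved factor by factor. Associativity is applied to vectors and
  then transferred to functions.\<close>

lemma row_apply_LSP:
  assumes "i < k"
  shows "row_apply B z i = row_apply L (row_apply S (row_apply P z)) i"
proof -
  have "B *\<^sub>v vec k z = L *\<^sub>v (S *\<^sub>v (P *\<^sub>v vec k z))"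
    using LSP carriers by (simp add: is_LSP_def assoc_mult_mat_vec[of _ k k _ k])
  moreover have 1: "(M *\<^sub>v v) $ i = row_apply M f i"
    if "M \<in> carrier_mat k k" "dim_vec v = k" "\<And>j. j < k \<Longrightarrow> v $ j = f j" "i < k" for M :: "'a mat" and v f i
  proof -
    have "row_apply M (\<lambda>j. v $ j) i = row_apply M f i"
      using that by (intro row_apply_cong) auto
    then show ?thesis
      using that by (simp add: row_scalar_prod)
  qed
  have "(P *\<^sub>v vec k z) $ j = row_apply P z j" if "j < k" for j
    using that carriers by (intro 1) auto
  then have "(S *\<^sub>v (P *\<^sub>v vec k z)) $ j = row_apply S (row_apply P z) j" if "j < k" for j
    using that carriers by (intro 1) auto
  then have "(L *\<^sub>v (S *\<^sub>v (P *\<^sub>v vec k z))) $ i = row_apply L (row_apply S (row_apply P z)) i"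
    using assms carriers by (intro 1) auto
  moreover have "(B *\<^sub>v vec k z) $ i = row_apply B z i"
    using assms B by (intro 1) auto
  ultimately show ?thesis
    by simp
qed

abbreviation "pivot_rows \<equiv> nonzero_rows S k"

lemma length_pivot_rows: "length pivot_rows \<le> k"
  unfolding nonzero_rows_def using length_filter_le[of _ "[0..<k]"] by simp

lemma set_pivot_rows: "set pivot_rows = {i. i < k \<and> (\<exists>j < k. S $$ (i, j) \<noteq> 0)}"
  by (auto simp: nonzero_rows_def)

lemma pivot_row_less: "a < length pivot_rows \<Longrightarrow> pivot_rows ! a < k"
  using nth_mem[of a pivot_rows] by (simp add: set_pivot_rows del: nth_mem)

text \<open>Triangularity refers to \<open>delete_zero_rows S\<close>, so non-zero row number
  \<open>a\<close> has its pivot in column \<open>a\<close>, whatever its index in \<open>S\<close>.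
  Hence back substitution needs no search for pivots, and the columns from
  \<open>length pivot_rows\<close> on are the free variables.\<close>

lemma pivot_row_zero: "a < length pivot_rows \<Longrightarrow> j < a \<Longrightarrow> S $$ (pivot_rows ! a, j) = 0"
  and pivot_row_nonzero: "a < length pivot_rows \<Longrightarrow> S $$ (pivot_rows ! a, a) \<noteq> 0"
proof -
  have *: "delete_zero_rows S $$ (a, j) = S $$ (pivot_rows ! a, j)"
    if "a < length pivot_rows" "j < k" for a j
    using that pivot_row_less[of a] by (simp add: delete_zero_rows_conv mat_of_rows_index)
  have dim: "dim_row (delete_zero_rows S) = length pivot_rows"
    by (simp add: delete_zero_rows_conv)
  show "a < length pivot_rows \<Longrightarrow> j < a \<Longrightarrow> S $$ (pivot_rows ! a, j) = 0"
    using LSP *[of a j] length_pivot_rows dim by (auto simp: is_LSP_def upper_triangular_def)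
  show "a < length pivot_rows \<Longrightarrow> S $$ (pivot_rows ! a, a) \<noteq> 0"
    using LSP *[of a a] length_pivot_rows dim by (auto simp: is_LSP_def)
qed

lemma not_pivot_row: "i < k \<Longrightarrow> i \<notin> set pivot_rows \<Longrightarrow> row_apply S x i = 0"
  by (auto simp: set_pivot_rows row_apply_def)

text \<open>Injectivity of \<open>L\<close> leaves no choice for \<open>w\<close>; this makes a
  failed test on a zero row of \<open>S\<close> conclusive.\<close>

lemma forward_solution_unique:
  assumes "\<And>i. i < k \<Longrightarrow> row_apply L w i = row_apply B z i" "i < k"
  shows "row_apply S (row_apply P z) i = w i"
proof (rule unit_lower_triangular_inj[OF carriers(1) L_diag L_upper])
  show "row_apply L (row_apply S (row_apply P z)) j = row_apply L w j" if "j < k" for j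
    using assms(1)[OF that] row_apply_LSP[OF that] by simp
qed (use assms in auto)

end

section \<open>The solver\<close>

notation Seq (infixr ";;" 60)

definition build_rows :: com where
  "build_rows = For ''i'' ''m''
     (IStore ''next'' (IVar ''i'') (IArr ''head'' (IArr ''A_row'' (IVar ''i''))) ;;
      IStore ''head'' (IArr ''A_row'' (IVar ''i'')) (Succ (IVar ''i'')))"

text \<open>\<open>X\<close> names the array of the current vector: \<open>y\<close> in the first
  pass, \<open>x\<close> in the second. The variable \<open>e\<close> holds a pointer, that is 1
  plus a position, hence the decrement.\<close>

definition scan_entry :: "string \<Rightarrow> com" where
  "scan_entry X =
     ISet ''e'' (Pred (IVar ''e'')) ;;
     FSet ''acc'' (FSub (FVar ''acc'')
       (FMul (FArr ''A_val'' (IVar ''e'')) (FArr X (IArr ''A_col'' (IVar ''e''))))) ;;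
     If (IEq (IArr ''A_col'' (IVar ''e'')) (IVar ''u''))
       (FSet ''piv'' (FArr ''A_val'' (IVar ''e''))) Skip ;;
     ISet ''e'' (IArr ''next'' (IVar ''e''))"

definition scan_row :: "string \<Rightarrow> com" where
  "scan_row X =
     (FSet ''acc'' (FArr ''b'' (IVar ''p'')) ;; ISet ''e'' (IArr ''head'' (IVar ''p''))) ;;
     While (BNot (IEq (IVar ''e'') (N 0))) (scan_entry X)"

definition forcing :: "string \<Rightarrow> com" where
  "forcing X = For ''i'' ''q''
     ((ISet ''p'' (IArr ''parent'' (IVar ''i'')) ;; ISet ''u'' (IArr ''forced'' (IVar ''i''))) ;;
      scan_row X ;;
      FStore X (IVar ''u'') (FDiv (FVar ''acc'') (FVar ''piv'')))"

text \<open>\<open>L\<close> and \<open>S\<close> have the same layout, so one pointer reads both: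
  \<open>L\<close> for the substitution, \<open>S\<close> to see whether its row is zero. The unit
  diagonal of \<open>L\<close> spares a division.\<close>

definition forward_step :: com where
  "forward_step =
     FSet ''acc'' (FSub (FVar ''acc'')
       (FMul (FArr ''L'' (IVar ''ptr'')) (FArr ''w'' (IVar ''j'')))) ;;
     If (FIsZero (FArr ''S'' (IVar ''ptr''))) Skip (ISet ''nz'' (N 1)) ;;
     ISet ''ptr'' (Succ (IVar ''ptr''))"

text \<open>The residual on the terminals is never stored: each entry is produced by scanning a
  terminal row and consumed at once. \<open>base\<close> remembers where row \<open>i\<close>
  starts, for use in the backward pass.\<close>

definition forward_row :: com where
  "forward_row =
     ISet ''p'' (IArr ''T'' (IVar ''i'')) ;;
     scan_row ''y'' ;;
     (IStore ''base'' (IVar ''i'') (IVar ''ptr'') ;; ISet ''nz'' (N 0)) ;;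
     For ''j'' ''k'' forward_step ;;
     FStore ''w'' (IVar ''i'') (FVar ''acc'') ;;
     If (IEq (IVar ''nz'') (N 0))
       (If (FIsZero (FVar ''acc'')) Skip (ISet ''fail'' (N 1)))
       (IStore ''idx'' (IVar ''r'') (IVar ''i'') ;; ISet ''r'' (Succ (IVar ''r'')))"

definition forward_substitution :: com where
  "forward_substitution =
     (ISet ''ptr'' (N 0) ;; ISet ''r'' (N 0) ;; ISet ''fail'' (N 0)) ;;
     For ''i'' ''k'' forward_row"

definition backward_step :: com where
  "backward_step =
     FSet ''acc'' (FSub (FVar ''acc'')
       (FMul (FArr ''S'' (IVar ''ptr'')) (FArr ''v'' (IVar ''j'')))) ;;
     If (IEq (IVar ''j'') (IVar ''a'')) (FSet ''piv'' (FArr ''S'' (IVar ''ptr''))) Skip ;;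
     ISet ''ptr'' (Succ (IVar ''ptr''))"

text \<open>The loop counter only counts iterations; the row is selected by \<open>a\<close>, which
  runs down from \<open>r\<close> and is decremented first.\<close>

definition backward_row :: com where
  "backward_row =
     (ISet ''a'' (Pred (IVar ''a'')) ;;
      FSet ''acc'' (FArr ''w'' (IArr ''idx'' (IVar ''a''))) ;;
      ISet ''ptr'' (IArr ''base'' (IArr ''idx'' (IVar ''a'')))) ;;
     For ''j'' ''k'' backward_step ;;
     FStore ''v'' (IVar ''a'') (FDiv (FVar ''acc'') (FVar ''piv''))"

definition backward_substitution :: com where
  "backward_substitution = ISet ''a'' (IVar ''r'') ;; For ''i'' ''r'' backward_row"

text \<open>Row \<open>i\<close> of \<open>P\<close> has its 1 in column \<sigma>\<open>i\<close>,
  so \<open>v i\<close> belongs to that position of \<open>Z\<close>. Reading all of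
  \<open>P\<close> inverts the permutation within the quadratic bound.\<close>

definition permute_step :: com where
  "permute_step =
     If (FIsZero (FArr ''P'' (IVar ''ptr''))) Skip
       (FStore ''x'' (IArr ''Z'' (IVar ''j'')) (FArr ''v'' (IVar ''i''))) ;;
     ISet ''ptr'' (Succ (IVar ''ptr''))"

definition permute_back :: com where
  "permute_back = ISet ''ptr'' (N 0) ;; For ''i'' ''k'' (For ''j'' ''k'' permute_step)"

definition solver :: com where
  "solver = build_rows ;; forcing ''y'' ;; forward_substitution ;; backward_substitution ;;
     permute_back ;; forcing ''x'' ;; If (IEq (IVar ''fail'') (N 0)) (ISet ''solvable'' (N 1)) Skip"

text \<open>Pointers are shifted by one, so that 0 marks the end of the list and a zero-initialised array
  of heads represents empty lists.\<close>

fun chain :: "(nat \<Rightarrow> nat) \<Rightarrow> nat \<Rightarrow> nat list \<Rightarrow> bool" where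
  "chain nxt h [] \<longleftrightarrow> h = 0"
| "chain nxt h (e # es) \<longleftrightarrow> h = Suc e \<and> chain nxt (nxt e) es"

lemma chain_fun_upd: "e \<notin> set es \<Longrightarrow> chain (nxt(e := h')) h es \<longleftrightarrow> chain nxt h es"
  by (induction es arbitrary: h) auto

text \<open>The reversal reflects that \<open>build_rows\<close> pushes each entry to the front of
  its list.\<close>

definition bucket :: "nat list \<Rightarrow> nat \<Rightarrow> nat \<Rightarrow> nat list" where
  "bucket rs i p = rev (filter (\<lambda>e. rs ! e = p) [0..<i])"

lemma bucket_Suc: "bucket rs (Suc i) p = (if rs ! i = p then i # bucket rs i p else bucket rs i p)"
  by (simp add: bucket_def)

lemma set_bucket: "set (bucket rs i p) = {e. e < i \<and> rs ! e = p}"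
  by (auto simp: bucket_def)

lemma distinct_bucket: "distinct (bucket rs i p)"
  by (simp add: bucket_def)

text \<open>An entry lies in one row only, so buckets of distinct rows are disjoint. This is applied
  both to the parents and to the terminals.\<close>

lemma sum_length_bucket:
  assumes "distinct ps"
  shows "(\<Sum>i<length ps. length (bucket rs m (ps ! i))) \<le> m"
proof -
  have "(\<Sum>i<length ps. length (bucket rs m (ps ! i))) =
      (\<Sum>i<length ps. card (set (bucket rs m (ps ! i))))"
    by (simp add: distinct_card distinct_bucket)
  also have "\<dots> = card (\<Union>i<length ps. set (bucket rs m (ps ! i)))"
    using assms by (subst card_UN_disjoint) (auto simp: set_bucket nth_eq_iff_index_eq)
  also have "\<dots> \<le> card {..<m}"
    by (intro card_mono) (auto simp: set_bucket)
  finally show ?thesis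
    by simp
qed

section \<open>Write sets of the parts of the program\<close>

lemma writes_build_rows [simp]: "writes build_rows = {IV ''i'', IA ''next'', IA ''head''}"
  by (auto simp: build_rows_def)

lemma writes_scan_row [simp]: "writes (scan_row X) = {FV ''acc'', IV ''e'', FV ''piv''}"
  by (auto simp: scan_row_def scan_entry_def)

lemma writes_forcing [simp]:
  "writes (forcing X) = {IV ''i'', IV ''p'', IV ''u'', FV ''acc'', IV ''e'', FV ''piv'', FA X}"
  by (auto simp: forcing_def)

lemma writes_forward_step [simp]: "writes forward_step = {FV ''acc'', IV ''nz'', IV ''ptr''}"
  by (auto simp: forward_step_def)

lemma writes_forward_row [simp]: "writes forward_row =
    {IV ''p'', FV ''acc'', IV ''e'', FV ''piv'', IA ''base'', IV ''nz'', IV ''j'', IV ''ptr'', FA ''w'',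
     IV ''fail'', IA ''idx'', IV ''r''}"
  by (auto simp: forward_row_def)

lemma writes_forward_substitution [simp]: "writes forward_substitution =
    {IV ''i'', IV ''p'', FV ''acc'', IV ''e'', FV ''piv'', IA ''base'', IV ''nz'', IV ''j'', IV ''ptr'',
     FA ''w'', IV ''fail'', IA ''idx'', IV ''r''}"
  by (auto simp: forward_substitution_def)

lemma writes_backward_step [simp]: "writes backward_step = {FV ''acc'', FV ''piv'', IV ''ptr''}"
  by (auto simp: backward_step_def)

lemma writes_backward_row [simp]: "writes backward_row =
    {IV ''a'', FV ''acc'', IV ''ptr'', IV ''j'', FV ''piv'', FA ''v''}"
  by (auto simp: backward_row_def)

lemma writes_backward_substitution [simp]: "writes backward_substitution =
    {IV ''i'', IV ''a'', FV ''acc'', IV ''ptr'', IV ''j'', FV ''piv'', FA ''v''}"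
  by (auto simp: backward_substitution_def)

lemma writes_permute_step [simp]: "writes permute_step = {FA ''x'', IV ''ptr''}"
  by (auto simp: permute_step_def)

lemma writes_permute_back [simp]: "writes permute_back = {IV ''i'', IV ''j'', FA ''x'', IV ''ptr''}"
  by (auto simp: permute_back_def)

lemma runs_build_rows:
  fixes s :: "'a::field state"
  assumes "ivar s ''m'' = length rs" "\<And>e. e < length rs \<Longrightarrow> iarr s ''A_row'' e = rs ! e"
    and "iarr s ''head'' = (\<lambda>_. 0)"
  shows "runs build_rows s (30 * length rs + 10)
    (\<lambda>s'. \<forall>p. chain (iarr s' ''next'') (iarr s' ''head'' p) (bucket rs (length rs) p))"
proof -
  define I where "I j s' \<longleftrightarrow>
    (\<forall>p. chain (iarr s' ''next'') (iarr s' ''head'' p) (bucket rs j p))" for j and s' :: "'a state"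
  have "runs build_rows s (30 * length rs + 10) (I (ivar s ''m''))"
    unfolding build_rows_def
  proof (rule runs_For)
    show "I 0 s"
      using assms by (simp add: I_def bucket_def)
  next
    fix j :: nat and s' :: "'a state"
    let ?c = "IStore ''next'' (IVar ''i'') (IArr ''head'' (IArr ''A_row'' (IVar ''i''))) ;;
      IStore ''head'' (IArr ''A_row'' (IVar ''i'')) (Succ (IVar ''i''))"
    assume j: "j < ivar s ''m''" "unchanged (writes (For ''i'' ''m'' ?c)) s s'" "ivar s' ''i'' = j" "I j s'"
    have "iarr s' ''A_row'' j = rs ! j"
      using j assms by (simp add: unchangedD(2)[OF j(2)])
    \<comment> \<open>Cell \<open>j\<close> is on no list yet, so overwriting its
      \<open>next\<close> pointer leaves all existing lists intact.\<close>
    then show "runs ?c s' 15 (I (Suc j))"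
      using j by (intro runs_loop_free)
        (auto simp: I_def bucket_Suc chain_fun_upd set_bucket)
  qed (use assms in \<open>auto simp: I_def\<close>)
  then show ?thesis
    using assms by (simp add: I_def[abs_def])
qed

section \<open>Correctness and cost of the passes over the sparse rows\<close>

locale solver_input = zero_forcing_system n A zs \<pi> + LSP_decomposition k B L S P \<sigma>
  for n and A :: "'a::field mat" and zs \<pi> k and B L S P :: "'a mat" and \<sigma> +
  fixes es :: "(nat \<times> nat \<times> 'a) list" and ts :: "nat list" and b :: "'a vec"
  assumes es: "represents es A"
    and ts: "distinct ts" "set ts = terminals A \<pi>"
    and k: "k = length zs"
    and B_def: "B = core_matrix A \<pi> ts zs"
    and b: "b \<in> carrier_vec n"
begin

text \<open>Weaker than equality with \<open>input_state\<close>: it speaks only about the locations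
  in \<open>input_locs\<close>, within their ranges, and is therefore preserved by every part of the
  program.\<close>

definition input :: "'a state \<Rightarrow> bool" where
  "input s \<longleftrightarrow> ivar s ''m'' = length es \<and> ivar s ''k'' = k \<and> ivar s ''q'' = length \<pi> \<and>
     (\<forall>e < length es. iarr s ''A_row'' e = fst (es ! e) \<and> iarr s ''A_col'' e = fst (snd (es ! e)) \<and>
        farr s ''A_val'' e = snd (snd (es ! e))) \<and>
     (\<forall>i < k. iarr s ''Z'' i = zs ! i \<and> iarr s ''T'' i = ts ! i) \<and>
     (\<forall>i < length \<pi>. iarr s ''forced'' i = fst (\<pi> ! i) \<and> iarr s ''parent'' i = snd (\<pi> ! i)) \<and>
     (\<forall>i < k. \<forall>j < k. farr s ''L'' (i * k + j) = L $$ (i, j) \<and> farr s ''S'' (i * k + j) = S $$ (i, j) \<and>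
        farr s ''P'' (i * k + j) = P $$ (i, j)) \<and>
     (\<forall>i < n. farr s ''b'' i = b $ i)"

definition input_locs :: "loc set" where
  "input_locs = {IV ''m'', IV ''k'', IV ''q'', IA ''A_row'', IA ''A_col'', FA ''A_val'', IA ''Z'', IA ''T'',
     IA ''forced'', IA ''parent'', FA ''L'', FA ''S'', FA ''P'', FA ''b''}"

lemma input_unchanged: "unchanged W s s' \<Longrightarrow> W \<inter> input_locs = {} \<Longrightarrow> input s \<Longrightarrow> input s'"
  by (simp add: input_def input_locs_def unchangedD)

abbreviation "entries \<equiv> bucket (map fst es) (length es)"

definition linked :: "'a state \<Rightarrow> bool" where
  "linked s \<longleftrightarrow> (\<forall>p. chain (iarr s ''next'') (iarr s ''head'' p) (entries p))"

lemma linked_unchanged: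
  "unchanged W s s' \<Longrightarrow> IA ''next'' \<notin> W \<Longrightarrow> IA ''head'' \<notin> W \<Longrightarrow> linked s \<Longrightarrow> linked s'"
  by (simp add: linked_def unchangedD)

lemma length_ts: "length ts = k"
  using length_terminals[OF ts] k by simp

lemma ts_less: "i < k \<Longrightarrow> ts ! i < n"
  using ts nth_mem[of i ts] length_ts by (auto simp: terminals_def)

lemma zs_less: "i < k \<Longrightarrow> zs ! i < n"
  using zs(2) k by (metis lessThan_iff nth_mem subsetD)

lemma set_es: "set es = {(i, j, A $$ (i, j)) |i j. i < n \<and> j < n \<and> A $$ (i, j) \<noteq> 0}"
  using es by (auto simp: represents_def nonzero_positions_def)

lemma length_es: "length es = card (nonzero_positions A)"
proof -
  have "length es = card ((\<lambda>(i, j). (i, j, A $$ (i, j))) ` nonzero_positions A)"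
    using es distinct_card[of es] by (simp add: represents_def)
  then show ?thesis
    by (simp add: card_image inj_on_def split: prod.splits)
qed

lemma entry:
  assumes "e \<in> set (entries p)"
  shows "e < length es" "fst (es ! e) = p" "fst (snd (es ! e)) < n"
    "snd (snd (es ! e)) = A $$ (p, fst (snd (es ! e)))"
proof -
  show e: "e < length es" "fst (es ! e) = p"
    using assms by (auto simp: set_bucket)
  then show "fst (snd (es ! e)) < n" "snd (snd (es ! e)) = A $$ (p, fst (snd (es ! e)))"
    using nth_mem[of e es] unfolding set_es by auto
qed

text \<open>\<open>represents\<close> lists each non-zero entry exactly once: surjectivity ensures
  that a scan of row \<open>p\<close> misses nothing, injectivity that it subtracts nothing
  twice.\<close>

lemma bij_betw_entries:
  assumes "p < n"
  shows "bij_betw (\<lambda>e. fst (snd (es ! e))) (set (entries p)) {j. j < n \<and> A $$ (p, j) \<noteq> 0}"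
  unfolding bij_betw_def
proof
  show "inj_on (\<lambda>e. fst (snd (es ! e))) (set (entries p))"
  proof (rule inj_onI)
    fix e e' assume e: "e \<in> set (entries p)" "e' \<in> set (entries p)"
      and eq: "fst (snd (es ! e)) = fst (snd (es ! e'))"
    then have "es ! e = es ! e'"
      using entry[of e p] entry[of e' p] by (simp add: prod_eq_iff)
    then show "e = e'"
      using es entry(1)[of e p] entry(1)[of e' p] e by (simp add: represents_def nth_eq_iff_index_eq)
  qed
  show "(\<lambda>e. fst (snd (es ! e))) ` set (entries p) = {j. j < n \<and> A $$ (p, j) \<noteq> 0}" (is "?f ` _ = ?R")
  proof
    show "?f ` set (entries p) \<subseteq> ?R"
    proof
      fix j assume "j \<in> ?f ` set (entries p)"
      then obtain e where e: "e < length es" "fst (es ! e) = p" "j = ?f e"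
        by (auto simp: set_bucket)
      then show "j \<in> ?R"
        using nth_mem[of e es] unfolding set_es by auto
    qed
    show "?R \<subseteq> ?f ` set (entries p)"
    proof
      fix j assume "j \<in> ?R"
      then have "(p, j, A $$ (p, j)) \<in> set es"
        using assms by (simp add: set_es)
      then obtain e where "e < length es" "es ! e = (p, j, A $$ (p, j))"
        by (auto simp: in_set_conv_nth)
      then show "j \<in> ?f ` set (entries p)"
        by (intro image_eqI[of _ _ e]) (auto simp: set_bucket)
    qed
  qed
qed

lemma sum_entries:
  assumes "p < n"
  shows "(\<Sum>e\<leftarrow>entries p. snd (snd (es ! e)) * x (fst (snd (es ! e)))) = row_apply A x p"
proof -
  have "(\<Sum>e\<leftarrow>entries p. snd (snd (es ! e)) * x (fst (snd (es ! e)))) =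
      (\<Sum>e\<in>set (entries p). A $$ (p, fst (snd (es ! e))) * x (fst (snd (es ! e))))"
    by (simp add: sum_list_distinct_conv_sum_set distinct_bucket entry cong: sum.cong)
  also have "\<dots> = (\<Sum>j | j < n \<and> A $$ (p, j) \<noteq> 0. A $$ (p, j) * x j)"
    by (rule sum.reindex_bij_betw[OF bij_betw_entries[OF assms]])
  also have "\<dots> = row_apply A x p"
    unfolding row_apply_def by (intro sum.mono_neutral_left) auto
  finally show ?thesis .
qed

lemma ex_entry:
  assumes "p < n" "u < n" "A $$ (p, u) \<noteq> 0"
  shows "\<exists>e \<in> set (entries p). fst (snd (es ! e)) = u"
proof -
  have "u \<in> (\<lambda>e. fst (snd (es ! e))) ` set (entries p)"
    using bij_betw_imp_surj_on[OF bij_betw_entries[OF assms(1)]] assms by simp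
  then show ?thesis
    by blast
qed

text \<open>The claim on \<open>piv\<close> is conditional because terminal rows are scanned by the
  same code, and there \<open>u\<close> is whatever the preceding pass has left.\<close>

lemma runs_scan_row:
  assumes "input s" "linked s" "ivar s ''p'' = p" "p < n"
  shows "runs (scan_row X) s (40 + 40 * length (entries p)) (\<lambda>s'.
    fvar s' ''acc'' = b $ p - row_apply A (farr s X) p \<and>
    (ivar s ''u'' < n \<and> A $$ (p, ivar s ''u'') \<noteq> 0 \<longrightarrow> fvar s' ''piv'' = A $$ (p, ivar s ''u'')))"
proof -
  let ?l = "entries p" and ?u = "ivar s ''u''" and ?b = "BNot (IEq (IVar ''e'') (N 0))"
  \<comment> \<open>\<open>next\<close> is not written by the scan, so the chain can refer to the
    initial state \<open>s\<close>.\<close>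
  define I where "I j s' \<longleftrightarrow> unchanged (writes (scan_row X)) s s' \<and>
    chain (iarr s ''next'') (ivar s' ''e'') (drop j ?l) \<and>
    fvar s' ''acc'' = b $ p - (\<Sum>e\<leftarrow>take j ?l. snd (snd (es ! e)) * farr s X (fst (snd (es ! e)))) \<and>
    ((\<exists>e \<in> set (take j ?l). fst (snd (es ! e)) = ?u) \<longrightarrow> fvar s' ''piv'' = A $$ (p, ?u))"
    for j and s' :: "'a state"
  \<comment> \<open>27 is the value of \<open>max_cost (scan_entry X)\<close>.\<close>
  have body: "bdefined ?b s' \<and> bval ?b s' \<and> runs (scan_entry X) s' 27 (I (Suc j))"
    if j: "j < length ?l" and I: "I j s'" for j s'
  proof -
    let ?e = "?l ! j"
    have e: "?e < length es" "snd (snd (es ! ?e)) = A $$ (p, fst (snd (es ! ?e)))"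
      using j entry[of ?e p] by auto
    have un: "unchanged (writes (scan_row X)) s s'"
      using I by (simp add: I_def)
    have in_s': "input s'"
      using input_unchanged[OF un _ assms(1)] by (simp add: input_locs_def)
    have drop: "drop j ?l = ?e # drop (Suc j) ?l"
      using j by (simp add: Cons_nth_drop_Suc)
    have ev: "ivar s' ''e'' = Suc ?e"
      using I by (simp add: I_def drop)
    have "I (Suc j) (effect (scan_entry X) s')"
      using I ev e in_s' un j
      unfolding I_def drop take_Suc_conv_app_nth[OF j]
      by (auto simp: scan_entry_def input_def unchanged_def)
    then show ?thesis
      using ev by (auto intro!: runs_loop_free simp: scan_entry_def)
  qed
  have 1: "runs (While ?b (scan_entry X)) s1 (35 * length ?l + 10) (I (length ?l))" if "I 0 s1" for s1
  proof (rule runs_weaken)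
    show "runs (While ?b (scan_entry X)) s1 ((\<Sum>j<length ?l. 1 + bcost ?b + 27) + (1 + bcost ?b)) (I (length ?l))"
      by (rule runs_While[OF that body]) (auto simp: I_def)
  qed auto
  have "runs (scan_row X) s (40 + 40 * length ?l) (I (length ?l))"
    unfolding scan_row_def
  proof (rule runs_Seq)
    show "runs (FSet ''acc'' (FArr ''b'' (IVar ''p'')) ;; ISet ''e'' (IArr ''head'' (IVar ''p''))) s 10 (I 0)"
      using assms by (intro runs_loop_free) (auto simp: I_def unchanged_def linked_def input_def)
    show "runs (While ?b (scan_entry X)) s1 (35 * length ?l + 10) (I (length ?l))" if "I 0 s1" for s1
      using 1[OF that] .
  qed auto
  then show ?thesis
    by (rule runs_weaken) (use assms ex_entry in \<open>auto simp: I_def sum_entries\<close>)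
qed

text \<open>The initial contents of \<open>X\<close> are arbitrary, so one statement serves the pass
  from zero and the pass from a core solution. The third assumption keeps the pass from overwriting
  its own input.\<close>

lemma runs_forcing:
  assumes "input s" "linked s" "FA X \<notin> input_locs"
  shows "runs (forcing X) s (80 * length \<pi> + 40 * length es + 10)
    (\<lambda>s'. farr s' X = foldl (assign A (($) b)) (farr s X) \<pi>)"
proof -
  define I where "I j s' \<longleftrightarrow> farr s' X = foldl (assign A (($) b)) (farr s X) (take j \<pi>)"
    for j and s' :: "'a state"
  let ?c = "(ISet ''p'' (IArr ''parent'' (IVar ''i'')) ;; ISet ''u'' (IArr ''forced'' (IVar ''i''))) ;;
      scan_row X ;; FStore X (IVar ''u'') (FDiv (FVar ''acc'') (FVar ''piv''))"
  have q: "ivar s ''q'' = length \<pi>"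
    using assms by (simp add: input_def)
  have "runs (forcing X) s (80 * length \<pi> + 40 * length es + 10) (I (ivar s ''q''))"
    unfolding forcing_def
  proof (rule runs_For)
    fix j :: nat and s' :: "'a state"
    assume j: "j < ivar s ''q''" "unchanged (writes (For ''i'' ''q'' ?c)) s s'" "ivar s' ''i'' = j" "I j s'"
    let ?p = "snd (\<pi> ! j)" and ?u = "fst (\<pi> ! j)"
    have un: "unchanged (writes (forcing X)) s s'"
      using j(2) by (simp add: forcing_def)
    have jq: "j < length \<pi>"
      using j q by simp
    have in_s': "input s'" "linked s'"
      using input_unchanged[OF un _ assms(1)] linked_unchanged[OF un _ _ assms(2)] assms(3)
      by (auto simp: input_locs_def)
    \<comment> \<open>The parent is written as \<open>map snd \<pi> ! j\<close> to match
      \<open>sum_length_bucket\<close> in the summation below.\<close>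
    show "runs ?c s' (70 + 40 * length (entries (map snd \<pi> ! j))) (I (Suc j))"
    proof (rule runs_Seq[where R = "\<lambda>s1. ivar s1 ''p'' = ?p \<and> ivar s1 ''u'' = ?u"])
      show "runs (ISet ''p'' (IArr ''parent'' (IVar ''i'')) ;; ISet ''u'' (IArr ''forced'' (IVar ''i''))) s' 10
          (\<lambda>s1. ivar s1 ''p'' = ?p \<and> ivar s1 ''u'' = ?u)"
        using in_s' j jq by (intro runs_loop_free) (auto simp: input_def)
    next
      fix s1
      assume s1: "unchanged (writes (ISet ''p'' (IArr ''parent'' (IVar ''i'')) ;; ISet ''u'' (IArr ''forced'' (IVar ''i'')))) s' s1"
        "ivar s1 ''p'' = ?p \<and> ivar s1 ''u'' = ?u"
      have in_s1: "input s1" "linked s1"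
        using input_unchanged[OF s1(1) _ in_s'(1)] linked_unchanged[OF s1(1) _ _ in_s'(2)]
        by (auto simp: input_locs_def)
      have X: "farr s1 X = farr s' X"
        using unchangedD(4)[OF s1(1)] by simp
      show "runs (scan_row X ;; FStore X (IVar ''u'') (FDiv (FVar ''acc'') (FVar ''piv''))) s1
          (50 + 40 * length (entries ?p)) (I (Suc j))"
      proof (rule runs_Seq)
        show "runs (scan_row X) s1 (40 + 40 * length (entries ?p)) (\<lambda>s2.
            fvar s2 ''acc'' = b $ ?p - row_apply A (farr s1 X) ?p \<and> 
            (ivar s1 ''u'' < n \<and> A $$ (?p, ivar s1 ''u'') \<noteq> 0 \<longrightarrow> fvar s2 ''piv'' = A $$ (?p, ivar s1 ''u'')))"
          using runs_scan_row[OF in_s1] s1(2) parent_less[OF jq] by simp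
      next
        fix s2
        assume s2: "unchanged (writes (scan_row X)) s1 s2"
          "fvar s2 ''acc'' = b $ ?p - row_apply A (farr s1 X) ?p \<and> 
            (ivar s1 ''u'' < n \<and> A $$ (?p, ivar s1 ''u'') \<noteq> 0 \<longrightarrow> fvar s2 ''piv'' = A $$ (?p, ivar s1 ''u''))"
        \<comment> \<open>The vertex \<open>?u\<close> is in the support of the row of
          \<open>?p\<close>, so the scan has met the pivot and the division is legal.\<close>
        have "fvar s2 ''piv'' = A $$ (?p, ?u)" "A $$ (?p, ?u) \<noteq> 0" "ivar s2 ''u'' = ?u" "farr s2 X = farr s' X"
          using s1(2) s2 forced_less[OF jq] pivot_nonzero[OF jq] X
          by (auto simp: unchangedD[OF s2(1)])
        then show "runs (FStore X (IVar ''u'') (FDiv (FVar ''acc'') (FVar ''piv''))) s2 7 (I (Suc j))"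
          using s2(2) j(4) X jq
          by (intro runs_loop_free) (simp_all add: I_def take_Suc_conv_app_nth assign_def)
      qed simp
    qed (use jq in simp)
  next
    have "(\<Sum>j<length \<pi>. length (entries (map snd \<pi> ! j))) \<le> length es"
      using sum_length_bucket[OF distinct_parents] by simp
    then show "(\<Sum>j<ivar s ''q''. 70 + 40 * length (entries (map snd \<pi> ! j))) + 10 * ivar s ''q'' + 10 \<le>
        80 * length \<pi> + 40 * length es + 10"
      unfolding q sum.distrib sum_distrib_left[symmetric] by simp
  qed (auto simp: I_def)
  then show ?thesis
    using q by (simp add: I_def[abs_def])
qed

section \<open>Forward substitution with \<open>L\<close>\<close>

lemma runs_forward_loop:
  assumes "input s" "i < k" "ivar s ''ptr'' = i * k" "ivar s ''nz'' = 0"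
  shows "runs (For ''j'' ''k'' forward_step) s (50 * k + 10) (\<lambda>s'.
    fvar s' ''acc'' = fvar s ''acc'' - row_apply L (farr s ''w'') i \<and>
    (ivar s' ''nz'' = 0 \<longleftrightarrow> (\<forall>l < k. S $$ (i, l) = 0)) \<and> ivar s' ''ptr'' = Suc i * k)"
proof -
  define I where "I j s' \<longleftrightarrow>
    fvar s' ''acc'' = fvar s ''acc'' - (\<Sum>l<j. L $$ (i, l) * farr s ''w'' l) \<and>
    (ivar s' ''nz'' = 0 \<longleftrightarrow> (\<forall>l < j. S $$ (i, l) = 0)) \<and> ivar s' ''ptr'' = i * k + j"
    for j and s' :: "'a state"
  have kk: "ivar s ''k'' = k"
    using assms by (simp add: input_def)
  have "runs (For ''j'' ''k'' forward_step) s (50 * k + 10) (I (ivar s ''k''))"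
  proof (rule runs_For)
    fix j s'
    assume j: "j < ivar s ''k''" "unchanged (writes (For ''j'' ''k'' forward_step)) s s'" "ivar s' ''j'' = j" "I j s'"
    have "input s'"
      using input_unchanged[OF j(2) _ assms(1)] by (simp add: input_locs_def)
    moreover have "farr s' ''w'' = farr s ''w''"
      using unchangedD(4)[OF j(2)] by simp
    ultimately show "runs forward_step s' 40 (I (Suc j))"
      using j kk assms(2)
      by (intro runs_loop_free) (auto simp: forward_step_def I_def input_def less_Suc_eq)
  qed (use assms kk in \<open>auto simp: I_def\<close>)
  then show ?thesis
    by (rule runs_weaken) (auto simp: I_def kk row_apply_def)
qed

text \<open>The scan of a terminal row yields this for whatever \<open>y\<close> holds;
  \<open>rhs_eq_residual\<close> identifies it for the result of the first forcing pass.\<close>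

definition rhs :: "(nat \<Rightarrow> 'a) \<Rightarrow> nat \<Rightarrow> 'a" where
  "rhs y i = b $ (ts ! i) - row_apply A y (ts ! i)"

lemma runs_forward_row:
  assumes s: "input s" "linked s" and i: "i < k" "ivar s ''i'' = i" "ivar s ''ptr'' = i * k"
  defines "c \<equiv> rhs (farr s ''y'') i - row_apply L (farr s ''w'') i"
  defines "null \<equiv> \<forall>l < k. S $$ (i, l) = 0"
  shows "runs forward_row s (150 + 50 * k + 40 * length (entries (ts ! i))) (\<lambda>s'.
    farr s' ''w'' = (farr s ''w'')(i := c) \<and> ivar s' ''ptr'' = Suc i * k \<and>
    iarr s' ''base'' = (iarr s ''base'')(i := i * k) \<and>
    iarr s' ''idx'' = (if null then iarr s ''idx'' else (iarr s ''idx'')(ivar s ''r'' := i)) \<and>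
    ivar s' ''r'' = (if null then ivar s ''r'' else Suc (ivar s ''r'')) \<and>
    ivar s' ''fail'' = (if null \<and> c \<noteq> 0 then 1 else ivar s ''fail''))"
  (is "runs _ _ _ ?Q")
proof -
  let ?p = "ts ! i"
  let ?c1 = "ISet ''p'' (IArr ''T'' (IVar ''i''))"
  let ?c3 = "IStore ''base'' (IVar ''i'') (IVar ''ptr'') ;; ISet ''nz'' (N 0)"
  let ?c5 = "FStore ''w'' (IVar ''i'') (FVar ''acc'') ;;
     If (IEq (IVar ''nz'') (N 0))
       (If (FIsZero (FVar ''acc'')) Skip (ISet ''fail'' (N 1)))
       (IStore ''idx'' (IVar ''r'') (IVar ''i'') ;; ISet ''r'' (Succ (IVar ''r'')))"
  show ?thesis
    unfolding forward_row_def
  proof (rule runs_Seq)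
    show "runs ?c1 s 3 (\<lambda>s1. ivar s1 ''p'' = ?p)"
      using s i by (intro runs_loop_free) (auto simp: input_def)
  next
    fix s1 assume s1: "unchanged (writes ?c1) s s1" "ivar s1 ''p'' = ?p"
    have in1: "input s1" "linked s1"
      using input_unchanged[OF s1(1)] linked_unchanged[OF s1(1)] s by (auto simp: input_locs_def)
    show "runs (scan_row ''y'' ;; ?c3 ;; For ''j'' ''k'' forward_step ;; ?c5) s1
        (140 + 50 * k + 40 * length (entries ?p)) ?Q"
    proof (rule runs_Seq)
      show "runs (scan_row ''y'') s1 (40 + 40 * length (entries ?p)) (\<lambda>s2. fvar s2 ''acc'' = rhs (farr s1 ''y'') i)"
        by (rule runs_weaken[OF runs_scan_row[OF in1 s1(2) ts_less[OF i(1)]]]) (auto simp: rhs_def)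
    next
      fix s2 assume s2: "unchanged (writes (scan_row ''y'')) s1 s2" "fvar s2 ''acc'' = rhs (farr s1 ''y'') i"
      have in2: "input s2"
        using input_unchanged[OF s2(1)] in1 by (auto simp: input_locs_def)
      have "unchanged {IV ''p'', FV ''acc'', IV ''e'', FV ''piv''} s s2"
        using s1(1) s2(1) by (auto simp: unchanged_def)
      note s2_eq = unchangedD[OF this]
      have acc2: "fvar s2 ''acc'' = rhs (farr s ''y'') i"
        using s2(2) unchangedD(4)[OF s1(1)] by simp
      show "runs (?c3 ;; For ''j'' ''k'' forward_step ;; ?c5) s2 (90 + 50 * k) ?Q"
      proof (rule runs_Seq)
        show "runs ?c3 s2 10 (\<lambda>s3. ivar s3 ''nz'' = 0 \<and> iarr s3 ''base'' = (iarr s ''base'')(i := i * k))"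
          using s2_eq i by (intro runs_loop_free) auto
      next
        fix s3 assume s3: "unchanged (writes ?c3) s2 s3" 
          "ivar s3 ''nz'' = 0 \<and> iarr s3 ''base'' = (iarr s ''base'')(i := i * k)"
        have in3: "input s3"
          using input_unchanged[OF s3(1)] in2 by (auto simp: input_locs_def)
        note s3_eq = unchangedD[OF s3(1)]
        show "runs (For ''j'' ''k'' forward_step ;; ?c5) s3 (70 + 50 * k) ?Q"
        proof (rule runs_Seq)
          show "runs (For ''j'' ''k'' forward_step) s3 (50 * k + 10) (\<lambda>s4. fvar s4 ''acc'' = c \<and>
              (ivar s4 ''nz'' = 0 \<longleftrightarrow> null) \<and> ivar s4 ''ptr'' = Suc i * k)"
            by (rule runs_weaken[OF runs_forward_loop[OF in3 i(1)]])
              (use s3 s3_eq s2_eq i acc2 in \<open>simp_all add: c_def null_def\<close>)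
        next
          fix s4 assume s4: "unchanged (writes (For ''j'' ''k'' forward_step)) s3 s4"
            "fvar s4 ''acc'' = c \<and> (ivar s4 ''nz'' = 0 \<longleftrightarrow> null) \<and> ivar s4 ''ptr'' = Suc i * k"
          note s4_eq = unchangedD[OF s4(1)]
          show "runs ?c5 s4 50 ?Q"
            using s4(2) s4_eq s3(2) s3_eq s2_eq i by (intro runs_loop_free) auto
        qed simp
      qed simp
    qed simp
  qed simp
qed

lemma runs_forward_substitution:
  assumes s: "input s" "linked s" "farr s ''w'' = (\<lambda>_. 0)"
  shows "runs forward_substitution s (160 * k + 50 * k\<^sup>2 + 40 * length es + 50) (\<lambda>s'.
    (\<forall>i < k. row_apply L (farr s' ''w'') i = rhs (farr s ''y'') i) \<and>
    (\<forall>i < k. iarr s' ''base'' i = i * k) \<and>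
    ivar s' ''r'' = length pivot_rows \<and> (\<forall>a < length pivot_rows. iarr s' ''idx'' a = pivot_rows ! a) \<and>
    (ivar s' ''fail'' = 0 \<longleftrightarrow> (\<forall>i < k. i \<notin> set pivot_rows \<longrightarrow> farr s' ''w'' i = 0)))"
  (is "runs _ _ _ ?Q")
proof -
  let ?nzr = "nonzero_rows S"
  define I where "I i s' \<longleftrightarrow> ivar s' ''ptr'' = i * k \<and>
    (\<forall>i' < i. i' < k \<longrightarrow> row_apply L (farr s' ''w'') i' = rhs (farr s ''y'') i') \<and>
    (\<forall>j \<ge> i. farr s' ''w'' j = 0) \<and>
    (\<forall>i' < i. iarr s' ''base'' i' = i' * k) \<and>
    ivar s' ''r'' = length (?nzr i) \<and> (\<forall>a < length (?nzr i). iarr s' ''idx'' a = ?nzr i ! a) \<and>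
    (ivar s' ''fail'' = 0 \<longleftrightarrow> (\<forall>i' < i. i' \<notin> set (?nzr i) \<longrightarrow> farr s' ''w'' i' = 0))"
    for i and s' :: "'a state"
  have nzr_Suc: "?nzr (Suc i) = (if \<forall>l < k. S $$ (i, l) = 0 then ?nzr i else ?nzr i @ [i])" for i
    by (simp add: nonzero_rows_def)
  have nzr_less: "j \<in> set (?nzr i) \<Longrightarrow> j < i" for i j
    by (simp add: nonzero_rows_def)
  let ?c = "ISet ''ptr'' (N 0) ;; ISet ''r'' (N 0) ;; ISet ''fail'' (N 0)"
  let ?T = "\<lambda>i. 150 + 50 * k + 40 * length (entries (ts ! i))"
  show ?thesis
    unfolding forward_substitution_def
  proof (rule runs_Seq)
    show "runs ?c s 20 (I 0)"
      using s by (intro runs_loop_free) (auto simp: I_def nonzero_rows_def)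
  next
    fix s1 assume s1: "unchanged (writes ?c) s s1" "I 0 s1"
    have in1: "input s1" "linked s1"
      using input_unchanged[OF s1(1)] linked_unchanged[OF s1(1)] s by (auto simp: input_locs_def)
    have k1: "ivar s1 ''k'' = k"
      using in1 by (simp add: input_def)
    have "runs (For ''i'' ''k'' forward_row) s1 (160 * k + 50 * k\<^sup>2 + 40 * length es + 10) (I (ivar s1 ''k''))"
    proof (rule runs_For)
      fix i s'
      assume i: "i < ivar s1 ''k''" "unchanged (writes (For ''i'' ''k'' forward_row)) s1 s'" "ivar s' ''i'' = i" "I i s'"
      have in': "input s'" "linked s'"
        using input_unchanged[OF i(2)] linked_unchanged[OF i(2)] in1 by (auto simp: input_locs_def)
      have y: "farr s' ''y'' = farr s ''y''"
        using unchangedD(4)[OF i(2)] unchangedD(4)[OF s1(1)] by simp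
      have ik: "i < k"
        using i k1 by simp
      have I: "ivar s' ''ptr'' = i * k" "\<forall>i' < i. i' < k \<longrightarrow> row_apply L (farr s' ''w'') i' = rhs (farr s ''y'') i'"
        "\<forall>j \<ge> i. farr s' ''w'' j = 0" "\<forall>i' < i. iarr s' ''base'' i' = i' * k"
        "ivar s' ''r'' = length (?nzr i)" "\<forall>a < length (?nzr i). iarr s' ''idx'' a = ?nzr i ! a"
        "ivar s' ''fail'' = 0 \<longleftrightarrow> (\<forall>i' < i. i' \<notin> set (?nzr i) \<longrightarrow> farr s' ''w'' i' = 0)"
        using i(4) unfolding I_def by blast+
      show "runs forward_row s' (?T i) (I (Suc i))"
      proof (rule runs_weaken[OF runs_forward_row])
        let ?w = "farr s' ''w''" and ?zero = "\<forall>l < k. S $$ (i, l) = 0"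
        let ?c = "rhs (farr s' ''y'') i - row_apply L ?w i"
        fix s2 :: "'a state"
        assume s2: "farr s2 ''w'' = ?w(i := ?c) \<and> ivar s2 ''ptr'' = Suc i * k \<and>
          iarr s2 ''base'' = (iarr s' ''base'')(i := i * k) \<and>
          iarr s2 ''idx'' = (if ?zero then iarr s' ''idx'' else (iarr s' ''idx'')(ivar s' ''r'' := i)) \<and>
          ivar s2 ''r'' = (if ?zero then ivar s' ''r'' else Suc (ivar s' ''r'')) \<and>
          ivar s2 ''fail'' = (if ?zero \<and> ?c \<noteq> 0 then 1 else ivar s' ''fail'')"
        have w0: "?w i = 0"
          using I(3) by simp
        \<comment> \<open>Column \<open>i\<close> of \<open>L\<close> is 0 above the diagonal, so
          earlier equations persist; in row \<open>i\<close> the coefficient is 1, so adding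
          \<open>?c\<close> closes the gap exactly.\<close>
        have rows: "row_apply L (?w(i := ?c)) i' = rhs (farr s ''y'') i'" if "i' < Suc i" for i'
        proof -
          have "row_apply L (?w(i := ?c)) i' = row_apply L ?w i' + L $$ (i', i) * ?c"
            using ik w0 by (subst row_apply_fun_upd) simp_all
          then show ?thesis
            using that I(2) ik y L_upper[of i' i] L_diag[of i] by (cases "i' = i") simp_all
        qed
        \<comment> \<open>Passing to \<open>Suc i\<close> changes the list at most by
          \<open>i\<close> itself, so the condition on earlier rows is untouched and only that for
          row \<open>i\<close> is added.\<close>
        have fail: "(\<forall>i' < Suc i. i' \<notin> set (?nzr (Suc i)) \<longrightarrow> (?w(i := ?c)) i' = 0) \<longleftrightarrow>
            (\<forall>i' < i. i' \<notin> set (?nzr i) \<longrightarrow> ?w i' = 0) \<and> (?zero \<longrightarrow> ?c = 0)"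
          using nzr_less[of i i] by (auto simp: nzr_Suc less_Suc_eq)
        show "I (Suc i) s2"
          unfolding I_def
        proof (intro conjI)
          show "\<forall>i' < Suc i. i' < k \<longrightarrow> row_apply L (farr s2 ''w'') i' = rhs (farr s ''y'') i'"
            using rows s2 by simp
          show "\<forall>j \<ge> Suc i. farr s2 ''w'' j = 0"
            using I(3) s2 by simp
          show "\<forall>i' < Suc i. iarr s2 ''base'' i' = i' * k"
            using I(4) s2 by (simp add: less_Suc_eq)
          show "ivar s2 ''r'' = length (?nzr (Suc i))"
            using I(5) s2 by (simp add: nzr_Suc)
          show "\<forall>a < length (?nzr (Suc i)). iarr s2 ''idx'' a = ?nzr (Suc i) ! a"
            using I(5,6) s2 by (auto simp: nzr_Suc nth_append less_Suc_eq)
          have if_zero: "(if Z \<and> C \<noteq> 0 then 1 else f) = 0 \<longleftrightarrow> f = 0 \<and> (Z \<longrightarrow> C = 0)"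
            for Z and C :: 'a and f :: nat
            by simp
          have "ivar s2 ''fail'' = (if ?zero \<and> ?c \<noteq> 0 then 1 else ivar s' ''fail'')"
            using s2 by blast
          then have "ivar s2 ''fail'' = 0 \<longleftrightarrow> ivar s' ''fail'' = 0 \<and> (?zero \<longrightarrow> ?c = 0)"
            using if_zero by metis
          moreover have "farr s2 ''w'' = ?w(i := ?c)"
            using s2 by blast
          ultimately show "ivar s2 ''fail'' = 0 \<longleftrightarrow>
              (\<forall>i' < Suc i. i' \<notin> set (?nzr (Suc i)) \<longrightarrow> farr s2 ''w'' i' = 0)"
            using I(7) fail by simp
        qed (use s2 in simp)
      qed (use in' ik i in \<open>auto simp: I_def\<close>)
    next
      have "(\<Sum>i<k. length (entries (ts ! i))) \<le> length es"
        using sum_length_bucket[OF ts(1)] length_ts by simp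
      then show "(\<Sum>j<ivar s1 ''k''. ?T j) + 10 * ivar s1 ''k'' + 10 \<le> 160 * k + 50 * k\<^sup>2 + 40 * length es + 10"
        unfolding k1 sum.distrib sum_distrib_left[symmetric] by (simp add: power2_eq_square algebra_simps)
    qed (use s1 in \<open>auto simp: I_def\<close>)
    then show "runs (For ''i'' ''k'' forward_row) s1 (160 * k + 50 * k\<^sup>2 + 40 * length es + 10) ?Q"
      by (rule runs_weaken) (auto simp: I_def k1)
  qed simp
qed

section \<open>Back substitution with the non-zero rows of \<open>S\<close>\<close>

lemma runs_backward_loop:
  assumes "input s" "i < k" "ivar s ''ptr'' = i * k" "ivar s ''a'' < k"
  shows "runs (For ''j'' ''k'' backward_step) s (50 * k + 10) (\<lambda>s'.
    fvar s' ''acc'' = fvar s ''acc'' - row_apply S (farr s ''v'') i \<and>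
    fvar s' ''piv'' = S $$ (i, ivar s ''a''))"
proof -
  define I where "I j s' \<longleftrightarrow>
    fvar s' ''acc'' = fvar s ''acc'' - (\<Sum>l<j. S $$ (i, l) * farr s ''v'' l) \<and>
    (ivar s ''a'' < j \<longrightarrow> fvar s' ''piv'' = S $$ (i, ivar s ''a'')) \<and> ivar s' ''ptr'' = i * k + j"
    for j and s' :: "'a state"
  have kk: "ivar s ''k'' = k"
    using assms by (simp add: input_def)
  have "runs (For ''j'' ''k'' backward_step) s (50 * k + 10) (I (ivar s ''k''))"
  proof (rule runs_For)
    fix j s'
    assume j: "j < ivar s ''k''" "unchanged (writes (For ''j'' ''k'' backward_step)) s s'" "ivar s' ''j'' = j" "I j s'"
    have "input s'"
      using input_unchanged[OF j(2) _ assms(1)] by (simp add: input_locs_def)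
    moreover have "farr s' ''v'' = farr s ''v''" "ivar s' ''a'' = ivar s ''a''"
      using unchangedD[OF j(2)] by simp_all
    ultimately show "runs backward_step s' 40 (I (Suc j))"
      using j kk assms(2)
      by (intro runs_loop_free) (auto simp: backward_step_def I_def input_def less_Suc_eq)
  qed (use assms kk in \<open>auto simp: I_def\<close>)
  then show ?thesis
    by (rule runs_weaken) (use assms in \<open>auto simp: I_def kk row_apply_def\<close>)
qed

lemma runs_backward_row:
  assumes s: "input s" and a: "ivar s ''a'' = Suc a" "a < length pivot_rows"
    and i: "iarr s ''idx'' a = pivot_rows ! a" "iarr s ''base'' (pivot_rows ! a) = pivot_rows ! a * k"
  shows "runs backward_row s (50 * k + 50) (\<lambda>s'. ivar s' ''a'' = a \<and>
    farr s' ''v'' = (farr s ''v'')(a := (farr s ''w'' (pivot_rows ! a) -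
      row_apply S (farr s ''v'') (pivot_rows ! a)) / S $$ (pivot_rows ! a, a)))"
  (is "runs _ _ _ ?Q")
proof -
  let ?c1 = "ISet ''a'' (Pred (IVar ''a'')) ;;
      FSet ''acc'' (FArr ''w'' (IArr ''idx'' (IVar ''a''))) ;;
      ISet ''ptr'' (IArr ''base'' (IArr ''idx'' (IVar ''a'')))"
  let ?i = "pivot_rows ! a"
  have ak: "a < k"
    using a(2) length_pivot_rows by simp
  show ?thesis
    unfolding backward_row_def
  proof (rule runs_Seq)
    show "runs ?c1 s 20 (\<lambda>s1. ivar s1 ''a'' = a \<and> fvar s1 ''acc'' = farr s ''w'' ?i \<and> ivar s1 ''ptr'' = ?i * k)"
      using a i by (intro runs_loop_free) auto
  next
    fix s1 assume s1: "unchanged (writes ?c1) s s1"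
      "ivar s1 ''a'' = a \<and> fvar s1 ''acc'' = farr s ''w'' ?i \<and> ivar s1 ''ptr'' = ?i * k"
    have in1: "input s1"
      using input_unchanged[OF s1(1)] s by (auto simp: input_locs_def)
    note s1_eq = unchangedD[OF s1(1)]
    show "runs (For ''j'' ''k'' backward_step ;; FStore ''v'' (IVar ''a'') (FDiv (FVar ''acc'') (FVar ''piv''))) s1
        (50 * k + 20) ?Q"
    proof (rule runs_Seq)
      show "runs (For ''j'' ''k'' backward_step) s1 (50 * k + 10) (\<lambda>s2.
          fvar s2 ''acc'' = farr s ''w'' ?i - row_apply S (farr s ''v'') ?i \<and> fvar s2 ''piv'' = S $$ (?i, a))"
        by (rule runs_weaken[OF runs_backward_loop[OF in1 pivot_row_less[OF a(2)]]])
          (use s1(2) s1_eq ak in simp_all)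
    next
      fix s2 assume s2: "unchanged (writes (For ''j'' ''k'' backward_step)) s1 s2"
        "fvar s2 ''acc'' = farr s ''w'' ?i - row_apply S (farr s ''v'') ?i \<and> fvar s2 ''piv'' = S $$ (?i, a)"
      note s2_eq = unchangedD[OF s2(1)]
      show "runs (FStore ''v'' (IVar ''a'') (FDiv (FVar ''acc'') (FVar ''piv''))) s2 8 ?Q"
        using s2(2) s2_eq s1(2) s1_eq pivot_row_nonzero[OF a(2)]
        by (intro runs_loop_free) simp_all
    qed simp
  qed simp
qed

lemma runs_backward_substitution:
  assumes s: "input s" "farr s ''v'' = (\<lambda>_. 0)" and r: "ivar s ''r'' = length pivot_rows"
    and idx: "\<And>a. a < length pivot_rows \<Longrightarrow> iarr s ''idx'' a = pivot_rows ! a"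
    and base: "\<And>i. i < k \<Longrightarrow> iarr s ''base'' i = i * k"
  shows "runs backward_substitution s (50 * k\<^sup>2 + 60 * k + 50) (\<lambda>s'. \<forall>a < length pivot_rows.
    row_apply S (farr s' ''v'') (pivot_rows ! a) = farr s ''w'' (pivot_rows ! a))"
  (is "runs _ _ _ ?Q")
proof -
  let ?r = "length pivot_rows"
  \<comment> \<open>After \<open>t\<close> iterations the last \<open>t\<close> pivot rows are
    solved. The coordinates below \<open>?r - t\<close> are still 0, so in the next row the
    subtraction may include the pivot term.\<close>
  define I where "I t s' \<longleftrightarrow> ivar s' ''a'' = ?r - t \<and>
    (\<forall>a. ?r - t \<le> a \<and> a < ?r \<longrightarrow> row_apply S (farr s' ''v'') (pivot_rows ! a) = farr s ''w'' (pivot_rows ! a)) \<and>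
    (\<forall>j < ?r - t. farr s' ''v'' j = 0)"
    for t and s' :: "'a state"
  show ?thesis
    unfolding backward_substitution_def
  proof (rule runs_Seq)
    show "runs (ISet ''a'' (IVar ''r'')) s 10 (I 0)"
      using s r by (intro runs_loop_free) (auto simp: I_def)
  next
    fix s1 assume s1: "unchanged (writes (ISet ''a'' (IVar ''r''))) s s1" "I 0 s1"
    have in1: "input s1"
      using input_unchanged[OF s1(1)] s by (auto simp: input_locs_def)
    have r1: "ivar s1 ''r'' = ?r"
      using unchangedD[OF s1(1)] r by simp
    have "runs (For ''i'' ''r'' backward_row) s1 (50 * k\<^sup>2 + 60 * k + 20) (I (ivar s1 ''r''))"
    proof (rule runs_For)
      fix t s'
      assume t: "t < ivar s1 ''r''" "unchanged (writes (For ''i'' ''r'' backward_row)) s1 s'" "ivar s' ''i'' = t" "I t s'"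
      define a where "a = ?r - Suc t"
      have a: "a < ?r" "?r - t = Suc a"
        using t r1 by (auto simp: a_def)
      have in': "input s'"
        using input_unchanged[OF t(2)] in1 by (auto simp: input_locs_def)
      have eq: "iarr s' ''idx'' = iarr s ''idx''" "iarr s' ''base'' = iarr s ''base''" "farr s' ''w'' = farr s ''w''"
        using unchangedD[OF t(2)] unchangedD[OF s1(1)] by simp_all
      let ?v = "farr s' ''v''" and ?i = "pivot_rows ! a"
      have I: "ivar s' ''a'' = Suc a" "\<And>a'. a < a' \<Longrightarrow> a' < ?r \<Longrightarrow> row_apply S ?v (pivot_rows ! a') = farr s ''w'' (pivot_rows ! a')"
        "\<And>j. j \<le> a \<Longrightarrow> ?v j = 0"
        using t(4) a unfolding I_def by auto
      show "runs backward_row s' (50 * k + 50) (I (Suc t))"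
      proof (rule runs_weaken[OF runs_backward_row[OF in' I(1) a(1)]])
        let ?c = "(farr s' ''w'' ?i - row_apply S ?v ?i) / S $$ (?i, a)"
        fix s2 :: "'a state"
        assume s2: "ivar s2 ''a'' = a \<and> farr s2 ''v'' = ?v(a := ?c)"
        \<comment> \<open>The update acts through column \<open>a\<close> of \<open>S\<close>, which
          is 0 in the later pivot rows and non-zero in row \<open>?i\<close>.\<close>
        have "row_apply S (?v(a := ?c)) i = row_apply S ?v i + S $$ (i, a) * ?c" for i
          using a(1) length_pivot_rows I(3)[of a] by (subst row_apply_fun_upd) simp_all
        then have "row_apply S (?v(a := ?c)) (pivot_rows ! a') = farr s ''w'' (pivot_rows ! a')"
          if "a \<le> a'" "a' < ?r" for a'
          using that I(2)[of a'] pivot_row_zero[of a' a] pivot_row_nonzero[OF a(1)] eq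
          by (cases "a' = a") simp_all
        then show "I (Suc t) s2"
          unfolding I_def a_def[symmetric] using s2 I(3) by simp
      qed (use idx[OF a(1)] base pivot_row_less[OF a(1)] eq in simp_all)
    next
      have "length pivot_rows * (50 * k + 60) \<le> k * (50 * k + 60)"
        by (intro mult_right_mono length_pivot_rows) simp
      then show "(\<Sum>t<ivar s1 ''r''. 50 * k + 50) + 10 * ivar s1 ''r'' + 10 \<le> 50 * k\<^sup>2 + 60 * k + 20"
        by (simp add: r1 power2_eq_square algebra_simps)
    qed (use s1 in \<open>auto simp: I_def\<close>)
    then show "runs (For ''i'' ''r'' backward_row) s1 (50 * k\<^sup>2 + 60 * k + 20) ?Q"
      by (rule runs_weaken) (auto simp: I_def r1)
  qed simp
qed

section \<open>Undoing the permutation\<close>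

lemma nth_zs_eq_iff: "i < k \<Longrightarrow> j < k \<Longrightarrow> zs ! i = zs ! j \<longleftrightarrow> i = j"
  using zs(1) k by (simp add: nth_eq_iff_index_eq)

text \<open>The zeros outside \<open>set zs\<close> are recorded because they are the start
  condition of \<open>satisfies_assign\<close> for the second forcing pass.\<close>

lemma runs_permute_back:
  assumes s: "input s" "farr s ''x'' = (\<lambda>_. 0)"
  shows "runs permute_back s (40 * k\<^sup>2 + 30 * k + 50) (\<lambda>s'.
    (\<forall>i < k. farr s' ''x'' (zs ! \<sigma> i) = farr s ''v'' i) \<and> (\<forall>u. u \<notin> set zs \<longrightarrow> farr s' ''x'' u = 0))"
  (is "runs _ _ _ ?Q")
proof -
  define I where "I i s' \<longleftrightarrow> ivar s' ''ptr'' = i * k \<and>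
    (\<forall>i' < i. i' < k \<longrightarrow> farr s' ''x'' (zs ! \<sigma> i') = farr s ''v'' i') \<and> (\<forall>u. u \<notin> set zs \<longrightarrow> farr s' ''x'' u = 0)"
    for i and s' :: "'a state"
  show ?thesis
    unfolding permute_back_def
  proof (rule runs_Seq)
    show "runs (ISet ''ptr'' (N 0)) s 10 (I 0)"
      using s by (intro runs_loop_free) (auto simp: I_def)
  next
    fix s1 assume s1: "unchanged (writes (ISet ''ptr'' (N 0))) s s1" "I 0 s1"
    have in1: "input s1"
      using input_unchanged[OF s1(1)] s by (auto simp: input_locs_def)
    have k1: "ivar s1 ''k'' = k"
      using in1 by (simp add: input_def)
    have "runs (For ''i'' ''k'' (For ''j'' ''k'' permute_step)) s1 (40 * k\<^sup>2 + 30 * k + 20) (I (ivar s1 ''k''))"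
    proof (rule runs_For)
      fix i s'
      assume i: "i < ivar s1 ''k''" "unchanged (writes (For ''i'' ''k'' (For ''j'' ''k'' permute_step))) s1 s'"
        "ivar s' ''i'' = i" "I i s'"
      \<comment> \<open>Row \<open>i\<close> counts as done once the scan has passed column
        \<sigma>\<open>i\<close>; the other columns leave \<open>x\<close> alone.\<close>
      define J where "J j s2 \<longleftrightarrow> ivar s2 ''ptr'' = i * k + j \<and>
        (\<forall>i' < k. i' < i \<or> i' = i \<and> \<sigma> i < j \<longrightarrow> farr s2 ''x'' (zs ! \<sigma> i') = farr s ''v'' i') \<and>
        (\<forall>u. u \<notin> set zs \<longrightarrow> farr s2 ''x'' u = 0)"
        for j and s2 :: "'a state"
      have ik: "i < k"
        using i k1 by simp
      have in': "input s'"
        using input_unchanged[OF i(2)] in1 by (auto simp: input_locs_def)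
      have k': "ivar s' ''k'' = k"
        using in' by (simp add: input_def)
      have v: "farr s' ''v'' = farr s ''v''"
        using unchangedD[OF i(2)] unchangedD[OF s1(1)] by simp
      have "runs (For ''j'' ''k'' permute_step) s' (40 * k + 10) (J (ivar s' ''k''))"
      proof (rule runs_For)
        fix j s2
        assume j: "j < ivar s' ''k''" "unchanged (writes (For ''j'' ''k'' permute_step)) s' s2"
          "ivar s2 ''j'' = j" "J j s2"
        have jk: "j < k"
          using j k' by simp
        have in2: "input s2"
          using input_unchanged[OF j(2)] in' by (auto simp: input_locs_def)
        have v2: "farr s2 ''v'' = farr s ''v''" "ivar s2 ''i'' = i"
          using unchangedD[OF j(2)] v i(3) by simp_all
        have J: "ivar s2 ''ptr'' = i * k + j" "\<And>u. u \<notin> set zs \<Longrightarrow> farr s2 ''x'' u = 0"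
          "\<And>i'. i' < k \<Longrightarrow> i' < i \<or> i' = i \<and> \<sigma> i < j \<Longrightarrow> farr s2 ''x'' (zs ! \<sigma> i') = farr s ''v'' i'"
          using j(4) by (auto simp: J_def)
        have in2': "farr s2 ''P'' (i * k + j) = (if j = \<sigma> i then 1 else 0)" "iarr s2 ''Z'' j = zs ! j"
          using in2 jk ik by (simp_all add: input_def P_index)
        have "effect permute_step s2 = seti ''ptr'' (Suc (i * k + j))
            (if j = \<sigma> i then s2\<lparr>farr := (farr s2)(''x'' := (farr s2 ''x'')(zs ! j := farr s ''v'' i))\<rparr> else s2)"
          using J(1) in2' v2 j(3) by (cases "j = \<sigma> i") (simp_all add: permute_step_def)
        moreover have "zs ! j \<in> set zs"
          using jk k by simp
        \<comment> \<open>As \<open>zs\<close> is distinct and \<sigma> is injective, a store never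
          hits a position written for another row.\<close>
        ultimately have "J (Suc j) (effect permute_step s2)"
          unfolding J_def using J(2,3) \<sigma>_less nth_zs_eq_iff \<sigma>_eq_iff jk
          by (auto simp: less_Suc_eq)
        then show "runs permute_step s2 30 (J (Suc j))"
          by (intro runs_loop_free) (auto simp: permute_step_def)
      qed (use i k' in \<open>auto simp: I_def J_def\<close>)
      then show "runs (For ''j'' ''k'' permute_step) s' (40 * k + 10) (I (Suc i))"
        by (rule runs_weaken) (use \<sigma>_less ik in \<open>auto simp: I_def J_def k' less_Suc_eq\<close>)
    qed (use s1 in \<open>auto simp: I_def k1 power2_eq_square algebra_simps\<close>)
    then show "runs (For ''i'' ''k'' (For ''j'' ''k'' permute_step)) s1 (40 * k\<^sup>2 + 30 * k + 20) ?Q"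
      by (rule runs_weaken) (auto simp: I_def k1)
  qed simp
qed

section \<open>Correctness of the answer and total time\<close>

lemma rhs_eq_residual:
  assumes "i < k"
  shows "rhs (foldl (assign A (($) b)) (\<lambda>_. 0) \<pi>) i = residual A \<pi> b $ (ts ! i)"
proof -
  have "row_apply A (($) (Forcing A \<pi> b)) (ts ! i) =
      row_apply A (foldl (assign A (($) b)) (\<lambda>_. 0) \<pi>) (ts ! i)"
    by (intro row_apply_cong) (simp add: Forcing_index)
  then show ?thesis
    using residual_index[OF ts_less[OF assms]] b by (simp add: rhs_def)
qed

text \<open>Solving the pivot rows gives \<open>S v = w\<close> in every row, as in the others both
  sides are 0. Since \<open>P\<close> carries the values on \<open>set zs\<close> to
  \<open>v\<close>, and \<open>L\<close> carries \<open>w\<close> to the residual, these values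
  solve the core system; the second pass satisfies the parent equations without changing
  them.\<close>

lemma solution:
  fixes w v x0 :: "nat \<Rightarrow> 'a"
  assumes w: "\<And>i. i < k \<Longrightarrow> row_apply L w i = residual A \<pi> b $ (ts ! i)"
    and v: "\<And>a. a < length pivot_rows \<Longrightarrow> row_apply S v (pivot_rows ! a) = w (pivot_rows ! a)"
    and zero: "\<And>i. i < k \<Longrightarrow> i \<notin> set pivot_rows \<Longrightarrow> w i = 0"
    and x0: "\<And>i. i < k \<Longrightarrow> x0 (zs ! \<sigma> i) = v i" "\<And>u. u \<notin> set zs \<Longrightarrow> x0 u = 0"
  shows "A *\<^sub>v vec n (foldl (assign A (($) b)) x0 \<pi>) = b"
proof -
  define x where "x = foldl (assign A (($) b)) x0 \<pi>"
  have x: "satisfies (($) b) x" "\<And>u. u \<in> set zs \<Longrightarrow> x u = x0 u"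
    unfolding x_def using x0(2) by (intro satisfies_assign; simp)+
  have vec: "row_apply A (($) (vec n x)) p = row_apply A x p" for p
    by (intro row_apply_cong) simp
  have Sv: "row_apply S v i = w i" if "i < k" for i
    using v zero[OF that] not_pivot_row[OF that] by (cases "i \<in> set pivot_rows") (auto simp: in_set_conv_nth)
  have "row_apply B (\<lambda>j. vec n x $ (zs ! j)) i = residual A \<pi> b $ (ts ! i)" if i: "i < k" for i
  proof -
    have "row_apply P (\<lambda>j. vec n x $ (zs ! j)) l = v l" if "l < k" for l
      using that x0(1) x(2)[of "zs ! \<sigma> l"] zs_less \<sigma>_less k by (simp add: row_apply_P)
    then have "row_apply S (row_apply P (\<lambda>j. vec n x $ (zs ! j))) l = row_apply S v l" for l
      by (intro row_apply_cong) simp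
    then have "row_apply L (row_apply S (row_apply P (\<lambda>j. vec n x $ (zs ! j)))) i = row_apply L w i"
      using Sv by (intro row_apply_cong) simp
    then show ?thesis
      using row_apply_LSP[OF i] w[OF i] by simp
  qed
  moreover have "satisfies (($) b) (($) (vec n x))"
    using x(1) by (simp add: satisfies_def vec)
  ultimately show ?thesis
    using solves_iff[OF b _ ts(2), of "vec n x"] by (simp add: x_def B_def length_ts)
qed

text \<open>Such an \<open>i\<close> is a certificate: by uniqueness of \<open>w\<close>, a solution
  would make the zero row \<open>i\<close> of \<open>S\<close> produce \<open>w i\<close>.\<close>

lemma no_solution:
  assumes w: "\<And>i. i < k \<Longrightarrow> row_apply L w i = residual A \<pi> b $ (ts ! i)"
    and i: "i < k" "i \<notin> set pivot_rows" "w i \<noteq> 0" and x: "x \<in> carrier_vec n"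
  shows "A *\<^sub>v x \<noteq> b"
proof
  assume "A *\<^sub>v x = b"
  then have "\<forall>i < k. row_apply B (\<lambda>j. x $ (zs ! j)) i = residual A \<pi> b $ (ts ! i)"
    using solves_iff[OF b x ts(2)] by (simp add: B_def length_ts)
  then have "row_apply S (row_apply P (\<lambda>j. x $ (zs ! j))) i = w i"
    using w i(1) by (intro forward_solution_unique) simp_all
  then show False
    using not_pivot_row[OF i(1,2)] i(3) by simp
qed

lemma length_\<pi>_le: "length \<pi> \<le> length es"
proof -
  have "distinct \<pi>"
    using \<pi> by (simp add: chronological_list_def distinct_map)
  then have "length \<pi> = card ((\<lambda>f. (snd f, fst f)) ` set \<pi>)"
    by (subst card_image) (auto simp: inj_on_def distinct_card)
  also have "\<dots> \<le> card (nonzero_positions A)"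
  proof (rule card_mono)
    show "finite (nonzero_positions A)"
      by (rule finite_subset[of _ "{..<n} \<times> {..<n}"]) (auto simp: nonzero_positions_def)
    show "(\<lambda>f. (snd f, fst f)) ` set \<pi> \<subseteq> nonzero_positions A"
    proof (rule image_subsetI)
      fix f assume "f \<in> set \<pi>"
      then obtain i where "i < length \<pi>" "f = \<pi> ! i"
        by (auto simp: in_set_conv_nth)
      then show "(snd f, fst f) \<in> nonzero_positions A"
        using parent_less forced_less pivot_nonzero by (simp add: nonzero_positions_def)
    qed
  qed
  finally show ?thesis
    by (simp add: length_es)
qed

lemma runs_solver:
  assumes s: "input s" and init: "iarr s ''head'' = (\<lambda>_. 0)" "ivar s ''solvable'' = 0"
    "farr s ''w'' = (\<lambda>_. 0)" "farr s ''v'' = (\<lambda>_. 0)" "farr s ''x'' = (\<lambda>_. 0)" "farr s ''y'' = (\<lambda>_. 0)"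
  shows "runs solver s (1000 * max 1 (k\<^sup>2 + length es)) (correct_output A b)"
proof -
  let ?m = "length es" and ?q = "length \<pi>"
  let ?final = "If (IEq (IVar ''fail'') (N 0)) (ISet ''solvable'' (N 1)) Skip"
  let ?F = "\<lambda>x. foldl (assign A (($) b)) x \<pi>"
  \<comment> \<open>These are budgets for the program still to be run; they accumulate from the end
    because \<open>runs_Seq\<close> nests to the right.\<close>
  let ?T6 = "50 + 80 * ?q + 40 * ?m"
  let ?T5 = "?T6 + 100 + 40 * k\<^sup>2 + 30 * k"
  let ?T4 = "?T5 + 100 + 50 * k\<^sup>2 + 60 * k"
  let ?T3 = "?T4 + 100 + 160 * k + 50 * k\<^sup>2 + 40 * ?m"
  let ?T2 = "?T3 + 50 + 80 * ?q + 40 * ?m"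
  have "runs solver s (?T2 + 50 + 30 * ?m) (correct_output A b)"
    unfolding solver_def
  proof (rule runs_Seq)
    show "runs build_rows s (30 * length (map fst es) + 10) linked"
      unfolding linked_def
      by (rule runs_weaken[OF runs_build_rows[of s "map fst es"]]) (use s init in \<open>auto simp: input_def\<close>)
  next
    fix s1 assume s1: "unchanged (writes build_rows) s s1" "linked s1"
    note eq1 = unchangedD[OF s1(1)]
    have in1: "input s1"
      using input_unchanged[OF s1(1) _ s] by (simp add: input_locs_def)
    show "runs (forcing ''y'' ;; forward_substitution ;; backward_substitution ;; permute_back ;;
        forcing ''x'' ;; ?final) s1 ?T2 (correct_output A b)"
    proof (rule runs_Seq)
      show "runs (forcing ''y'') s1 (80 * ?q + 40 * ?m + 10) (\<lambda>s2. farr s2 ''y'' = ?F (\<lambda>_. 0))"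
        by (rule runs_weaken[OF runs_forcing[OF in1 s1(2)]]) (use eq1 init in \<open>simp_all add: input_locs_def\<close>)
    next
      fix s2 assume s2: "unchanged (writes (forcing ''y'')) s1 s2" "farr s2 ''y'' = ?F (\<lambda>_. 0)"
      note eq2 = unchangedD[OF s2(1)]
      have in2: "input s2" "linked s2"
        using input_unchanged[OF s2(1) _ in1] linked_unchanged[OF s2(1) _ _ s1(2)] by (simp_all add: input_locs_def)
      let ?Q3 = "\<lambda>s3. (\<forall>i < k. row_apply L (farr s3 ''w'') i = residual A \<pi> b $ (ts ! i)) \<and>
          (\<forall>i < k. iarr s3 ''base'' i = i * k) \<and>
          ivar s3 ''r'' = length pivot_rows \<and> (\<forall>a < length pivot_rows. iarr s3 ''idx'' a = pivot_rows ! a) \<and>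
          (ivar s3 ''fail'' = 0 \<longleftrightarrow> (\<forall>i < k. i \<notin> set pivot_rows \<longrightarrow> farr s3 ''w'' i = 0))"
      show "runs (forward_substitution ;; backward_substitution ;; permute_back ;; forcing ''x'' ;; ?final)
          s2 ?T3 (correct_output A b)"
      proof (rule runs_Seq)
        show "runs forward_substitution s2 (160 * k + 50 * k\<^sup>2 + 40 * length es + 50) ?Q3"
          by (rule runs_weaken[OF runs_forward_substitution[OF in2]])
            (use eq2 eq1 init in \<open>simp_all add: s2(2) rhs_eq_residual\<close>)
      next
        fix s3 assume s3: "unchanged (writes forward_substitution) s2 s3" "?Q3 s3"
        note eq3 = unchangedD[OF s3(1)]
        have in3: "input s3" "linked s3"
          using input_unchanged[OF s3(1) _ in2(1)] linked_unchanged[OF s3(1) _ _ in2(2)] by (simp_all add: input_locs_def)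
        have w: "row_apply L (farr s3 ''w'') i = residual A \<pi> b $ (ts ! i)" if "i < k" for i
          using s3(2) that by blast
        have fail: "ivar s3 ''fail'' = 0 \<longleftrightarrow> (\<forall>i < k. i \<notin> set pivot_rows \<longrightarrow> farr s3 ''w'' i = 0)"
          using s3(2) by blast
        show "runs (backward_substitution ;; permute_back ;; forcing ''x'' ;; ?final) s3 ?T4 (correct_output A b)"
        proof (rule runs_Seq)
          show "runs backward_substitution s3 (50 * k\<^sup>2 + 60 * k + 50) (\<lambda>s4. \<forall>a < length pivot_rows.
              row_apply S (farr s4 ''v'') (pivot_rows ! a) = farr s3 ''w'' (pivot_rows ! a))"
            using s3(2) eq3 eq2 eq1 init by (intro runs_backward_substitution[OF in3(1)]) simp_all
        next
          fix s4 assume s4: "unchanged (writes backward_substitution) s3 s4"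
            "\<forall>a < length pivot_rows. row_apply S (farr s4 ''v'') (pivot_rows ! a) = farr s3 ''w'' (pivot_rows ! a)"
          note eq4 = unchangedD[OF s4(1)]
          have in4: "input s4" "linked s4"
            using input_unchanged[OF s4(1) _ in3(1)] linked_unchanged[OF s4(1) _ _ in3(2)] by (simp_all add: input_locs_def)
          show "runs (permute_back ;; forcing ''x'' ;; ?final) s4 ?T5 (correct_output A b)"
          proof (rule runs_Seq)
            show "runs permute_back s4 (40 * k\<^sup>2 + 30 * k + 50) (\<lambda>s5.
                (\<forall>i < k. farr s5 ''x'' (zs ! \<sigma> i) = farr s4 ''v'' i) \<and> (\<forall>u. u \<notin> set zs \<longrightarrow> farr s5 ''x'' u = 0))"
              using eq4 eq3 eq2 eq1 init by (intro runs_permute_back[OF in4(1)]) simp_all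
          next
            fix s5 assume s5: "unchanged (writes permute_back) s4 s5"
              "(\<forall>i < k. farr s5 ''x'' (zs ! \<sigma> i) = farr s4 ''v'' i) \<and> (\<forall>u. u \<notin> set zs \<longrightarrow> farr s5 ''x'' u = 0)"
            note eq5 = unchangedD[OF s5(1)]
            have in5: "input s5" "linked s5"
              using input_unchanged[OF s5(1) _ in4(1)] linked_unchanged[OF s5(1) _ _ in4(2)] by (simp_all add: input_locs_def)
            show "runs (forcing ''x'' ;; ?final) s5 ?T6 (correct_output A b)"
            proof (rule runs_Seq)
              show "runs (forcing ''x'') s5 (80 * ?q + 40 * ?m + 10) (\<lambda>s6. farr s6 ''x'' = ?F (farr s5 ''x''))"
                by (rule runs_forcing[OF in5]) (simp add: input_locs_def)
            next
              fix s6 assume s6: "unchanged (writes (forcing ''x'')) s5 s6" "farr s6 ''x'' = ?F (farr s5 ''x'')"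
              note eq6 = unchangedD[OF s6(1)]
              have fail6: "ivar s6 ''fail'' = ivar s3 ''fail''" and solv6: "ivar s6 ''solvable'' = 0"
                using eq6 eq5 eq4 eq3 eq2 eq1 init by simp_all
              \<comment> \<open>\<open>fail\<close> is not written after forward substitution, so
                the final test still speaks about \<open>w\<close>, although the later passes have
                run in either case.\<close>
              have "correct_output A b (effect ?final s6)"
              proof (cases "ivar s3 ''fail'' = 0")
                case True
                then have "A *\<^sub>v vec n (farr s6 ''x'') = b"
                  unfolding s6(2) using fail s4(2) s5(2) by (intro solution[OF w]) simp_all
                then show ?thesis
                  using True fail6 by (simp add: correct_output_def reports_solvable_def output_vec_def)
              next
                case False
                then obtain i where "i < k" "i \<notin> set pivot_rows" "farr s3 ''w'' i \<noteq> 0"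
                  using fail by auto
                then have "\<not> (\<exists>x \<in> carrier_vec n. A *\<^sub>v x = b)"
                  using no_solution[OF w] by blast
                then show ?thesis
                  using False fail6 solv6 by (simp add: correct_output_def reports_solvable_def)
              qed
              then show "runs ?final s6 10 (correct_output A b)"
                by (intro runs_loop_free) auto
            qed simp
          qed simp
        qed simp
      qed simp
    qed simp
  qed simp
  then show ?thesis
  proof (rule runs_weaken)
    have "k \<le> k\<^sup>2"
      by (cases k) (simp_all add: power2_eq_square)
    moreover define M where "M = max 1 (k\<^sup>2 + ?m)"
    then have "1 \<le> M" "k\<^sup>2 + ?m \<le> M"
      by simp_all
    \<comment> \<open>With \<open>k\<close> at most its square and \<open>?q\<close> at most
      \<open>?m\<close>, the total is at most 450, plus 390 times the square of \<open>k\<close>,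
      plus 310 times \<open>?m\<close>; this is at most \<open>840 * M\<close>. The case
      \<open>k = 0\<close>, \<open>?m = 0\<close>, which means \<open>n = 0\<close>, is covered by
      \<open>1 \<le> M\<close>.\<close>
    ultimately have "?T2 + 50 + 30 * ?m \<le> 1000 * M"
      using length_\<pi>_le by linarith
    then show "?T2 + 50 + 30 * ?m \<le> 1000 * max 1 (k\<^sup>2 + ?m)"
      by (simp only: M_def)
  qed
qed

end

lemma row_major_index:
  assumes "M \<in> carrier_mat k k" "i < k" "j < k"
  shows "row_major M (i * k + j) = M $$ (i, j)"
proof -
  have "i * k + j < Suc i * k"
    using assms by simp
  also have "\<dots> \<le> k * k"
    using assms by (intro mult_right_mono) auto
  finally show ?thesis
    using assms by (simp add: row_major_def)
qed

text \<open>Program and constant are chosen before the dimension and the data, so the algorithm is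
  uniform. As \<open>exec\<close> is deterministic, exhibiting one good run settles what the program
  does.\<close>

theorem theorem7:
  shows "\<exists>(solver :: com) (C :: nat).
    \<forall>n (A :: 'a::field mat) es Z zs \<pi> ts L S P b.
      A \<in> carrier_mat n n \<longrightarrow> represents es A \<longrightarrow>
      zero_forcing_set A Z \<longrightarrow> distinct zs \<longrightarrow> set zs = Z \<longrightarrow>
      chronological_list A Z \<pi> \<longrightarrow>
      distinct ts \<longrightarrow> set ts = terminals A \<pi> \<longrightarrow>
      is_LSP (core_matrix A \<pi> ts zs) L S P \<longrightarrow>
      b \<in> carrier_vec n \<longrightarrow>
      (\<exists>t s. exec solver (input_state n es zs \<pi> ts L S P b) t s \<and>
             t \<le> C * max 1 ((card Z)\<^sup>2 + card (nonzero_positions A)) \<and>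
             correct_output A b s)"
proof (rule exI[of _ solver], rule exI[of _ 1000], intro allI impI)
  fix n and A :: "'a mat" and es Z zs \<pi> ts L S P and b :: "'a vec"
  assume A: "A \<in> carrier_mat n n" and es: "represents es A" and Z: "zero_forcing_set A Z"
    and zs: "distinct zs" "set zs = Z" and \<pi>: "chronological_list A Z \<pi>"
    and ts: "distinct ts" "set ts = terminals A \<pi>"
    and LSP: "is_LSP (core_matrix A \<pi> ts zs) L S P" and b: "b \<in> carrier_vec n"
  let ?k = "length zs" and ?B = "core_matrix A \<pi> ts zs" and ?s = "input_state n es zs \<pi> ts L S P b"
  have card_Z: "card Z = ?k"
    using zs distinct_card[of zs] by simp
  interpret zero_forcing_system n A zs \<pi>
    using A Z zs \<pi> by unfold_locales (auto simp: zero_forcing_set_def)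
  have k: "length ts = ?k"
    using length_terminals[OF ts] .
  have B: "?B \<in> carrier_mat ?k ?k"
    by (simp add: core_matrix_def k)
  then have "dim_row P = ?k"
    using LSP by (auto simp: is_LSP_def)
  \<comment> \<open>\<open>permutation_matrix\<close> refers to \<open>dim_row P\<close>; it is the
    squareness of the core matrix that identifies this with \<open>?k\<close>.\<close>
  then obtain \<sigma> where \<sigma>: "\<sigma> permutes {..<?k}" "P = mat ?k ?k (\<lambda>(i, j). if j = \<sigma> i then 1 else 0)"
    using LSP by (auto simp: is_LSP_def permutation_matrix_def)
  interpret solver_input n A zs \<pi> ?k ?B L S P \<sigma> es ts b
    using B LSP \<sigma> es ts b by unfold_locales simp_all
  have "input ?s"
    using b length_ts by (auto simp: input_def input_state_def list_array_def vec_array_def row_major_index[OF carriers(1)]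
      row_major_index[OF carriers(2)] row_major_index[OF carriers(3)])
  then have "runs solver ?s (1000 * max 1 (?k\<^sup>2 + length es)) (correct_output A b)"
    by (rule runs_solver) (simp_all add: input_state_def)
  then show "\<exists>t s. exec solver ?s t s \<and> t \<le> 1000 * max 1 ((card Z)\<^sup>2 + card (nonzero_positions A)) \<and>
      correct_output A b s"
    by (simp add: runs_def length_es card_Z)
qed

end
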